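(* Let $k$ be a positive integer and let $f$ be a homogeneous symmetric polynomial of degree $d$ in $n$ variables with an expansion \[f=\sum_{\mu\trianglelefteq\lambda}c_\mu\,\mathfrak{S}^{(k)}_\mu,\] where $\lambda$ is a $k$-bounded partition of $d$, the sum is over $k$-bounded partitions $\mu$, the $c_\mu$ are real, and the $\mathfrak{S}^{(k)}_\mu$ are dual $k$-Schur polynomials in $n$ variables. If $c_\lambda\neq0$ (and $c_\mu\ne0$ only if $\mu\trianglelefteq\lambda$), then $\mathrm{Newton}(f)=\mathcal{P}_\lambda$. Moreover, if in addition $c_\mu\ge0$ for all $\mu$, then $f$ has saturated Newton polytope and hence is M-convex.
   Context: Partitions are Young diagrams in French notation; $k$-bounded means largest part at most $k$. Dominance order: $\mu\trianglelefteq\lambda$ iff $\mu_1+\cdots+\mu_i\le\lambda_1+\cdots+\lambda_i$ for all $i$. Hook length of a cell: number of cells directly to its right or directly above it, counting the cell once; a $(k+1)$-core has no cell of hook length $k+1$; the $(k+1)$-residue of cell $(i,j)$ is $j-i\bmod(k+1)$. $\mathfrak{c}(\mu)$ is the unique $(k+1)$-core whose row $i$ contains exactly $\mu_i$ cells of hook length at most $k$. The dual $k$-Schur function is $\mathfrak{S}^{(k)}_\mu=\sum_T x^{k\text{-weight}(T)}$, summed over semistandard Young tableaux $T$ of shape $\mathfrak{c}(\mu)$, where the $k$-weight has $i$-th entry equal to the number of distinct $(k+1)$-residues of cells filled with $i$; restricting to $x_1,\ldots,x_n$ gives a polynomial. $\mathrm{supp}(f)$ is the set of exponent vectors with nonzero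 coefficient, $\mathrm{Newton}(f)$ its convex hull, and $f$ has saturated Newton polytope if $\mathrm{supp}(f)=\mathrm{Newton}(f)\cap\mathbb{Z}^n$. $\mathcal{P}_\lambda\subseteq\mathbb{R}^n$ is the convex hull of all permutations of $(\lambda_1,\ldots,\lambda_n)$ (padded with zeros). A polynomial is M-convex if its support $J$ satisfies: for all $\alpha,\beta\in J$ and $i$ with $\alpha_i>\beta_i$ there is $j$ with $\alpha_j<\beta_j$ and $\alpha-e_i+e_j\in J$.
   Formalization: It is assumed that λ has at most n parts (otherwise f = 0 and the Newton polytope claim fails), and the tableaux defining the dual k-Schur polynomials are those whose k-weight has total |μ|, as in the standard definition of k-tableaux. *)

theory Defs
  imports "HOL-Analysis.Analysis" "HOL-Library.Poly_Mapping" "HOL-Library.More_List"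
begin

section \<open>Partitions, cores and residues\<close>

definition is_partition :: "nat list \<Rightarrow> bool" where
  "is_partition mu \<longleftrightarrow> sorted_wrt (\<ge>) mu \<and> 0 \<notin> set mu"

text \<open>Parts are indexed from 0; \<open>part mu i = 0\<close> beyond the length of \<open>mu\<close>.\<close>

abbreviation part :: "nat list \<Rightarrow> nat \<Rightarrow> nat" where
  "part \<equiv> nth_default 0"

definition k_bounded_partition :: "nat \<Rightarrow> nat list \<Rightarrow> bool" where
  "k_bounded_partition k mu \<longleftrightarrow> is_partition mu \<and> (\<forall>p \<in> set mu. p \<le> k)"

text \<open>Equality of sizes is not required here. For partitions of the same size this is the
  usual dominance order.\<close>

definition dominated_by :: "nat list \<Rightarrow> nat list \<Rightarrow> bool" (infix "\<unlhd>" 50) where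
  "mu \<unlhd> la \<longleftrightarrow> (\<forall>i. (\<Sum>j<i. part mu j) \<le> (\<Sum>j<i. part la j))"

text \<open>Cells are pairs (row, column). In French notation row 0 is the bottom row, so the cells
  above a given one are those of larger row index.\<close>

definition diagram :: "nat list \<Rightarrow> (nat \<times> nat) set" where
  "diagram g = {(i, j). j < part g i}"

fun hook_length :: "nat list \<Rightarrow> nat \<times> nat \<Rightarrow> nat" where
  "hook_length g (i, j) =
     1 + card {j'. j < j' \<and> (i, j') \<in> diagram g} + card {i'. i < i' \<and> (i', j) \<in> diagram g}"

definition is_core :: "nat \<Rightarrow> nat list \<Rightarrow> bool" where
  "is_core m g \<longleftrightarrow> is_partition g \<and> (\<forall>x \<in> diagram g. hook_length g x \<noteq> m)"

fun residue :: "nat \<Rightarrow> nat \<times> nat \<Rightarrow> int" where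
  "residue m (i, j) = (int j - int i) mod int m"

definition core_of :: "nat \<Rightarrow> nat list \<Rightarrow> nat list" where
  "core_of k mu = (THE g. is_core (k + 1) g \<and>
     (\<forall>i. card {j. (i, j) \<in> diagram g \<and> hook_length g (i, j) \<le> k} = part mu i))"


section \<open>Polynomials in \<open>n\<close> variables and dual \<open>k\<close>-Schur polynomials\<close>

text \<open>The \<open>n\<close> variables are indexed by an arbitrary finite linearly ordered type \<open>'n\<close> with
  \<open>CARD('n) = n\<close>, which is also the alphabet of the tableaux. A polynomial maps exponent
  vectors to coefficients.\<close>

type_synonym 'n real_mpoly = "(nat ^ 'n) \<Rightarrow>\<^sub>0 real"

definition homogeneous_poly :: "nat \<Rightarrow> ('n::finite) real_mpoly \<Rightarrow> bool" where
  "homogeneous_poly d f \<longleftrightarrow> (\<forall>a \<in> Poly_Mapping.keys f. (\<Sum>i\<in>UNIV. a $ i) = d)"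

definition symmetric_poly :: "('n::finite) real_mpoly \<Rightarrow> bool" where
  "symmetric_poly f \<longleftrightarrow> (\<forall>p a. p permutes (UNIV :: 'n set) \<longrightarrow>
     Poly_Mapping.lookup f (\<chi> i. a $ p i) = Poly_Mapping.lookup f a)"

text \<open>Fillings are extensional, so that each tableau is represented by exactly one function.\<close>

definition ssyt :: "nat list \<Rightarrow> (nat \<times> nat \<Rightarrow> 'n::linorder) set" where
  "ssyt g = {T \<in> extensional (diagram g).
     (\<forall>i j j'. j < j' \<and> (i, j') \<in> diagram g \<longrightarrow> T (i, j) \<le> T (i, j')) \<and>
     (\<forall>i i' j. i < i' \<and> (i', j) \<in> diagram g \<longrightarrow> T (i, j) < T (i', j))}"

definition k_weight :: "nat \<Rightarrow> nat list \<Rightarrow> (nat \<times> nat \<Rightarrow> 'n::finite) \<Rightarrow> nat ^ 'n" where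
  "k_weight k g T = (\<chi> x. card (residue (k + 1) ` {c \<in> diagram g. T c = x}))"

text \<open>In the definition of \<open>k\<close>-tableaux (Lapointe and Morse) the \<open>k\<close>-weight is a composition of
  the number of cells of hook length at most \<open>k\<close>, that is, of the size of \<open>mu\<close>. Other
  semistandard fillings of the core exist: for \<open>k = 1\<close> and \<open>mu = [1, 1]\<close> the core is
  \<open>[2, 1]\<close>, and filling its three cells by distinct letters gives a \<open>k\<close>-weight of total 3.
  Without the size condition the sum would not be homogeneous.\<close>

definition k_tableaux :: "nat \<Rightarrow> nat list \<Rightarrow> (nat \<times> nat \<Rightarrow> 'n::{finite,linorder}) set" where
  "k_tableaux k mu = {T \<in> ssyt (core_of k mu).
     (\<Sum>x\<in>UNIV. k_weight k (core_of k mu) T $ x) = sum_list mu}"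

definition dual_k_schur :: "nat \<Rightarrow> nat list \<Rightarrow> ('n::{finite,linorder}) real_mpoly" where
  "dual_k_schur k mu =
     (\<Sum>T \<in> k_tableaux k mu. Poly_Mapping.single (k_weight k (core_of k mu) T) 1)"


section \<open>Newton polytopes and M-convexity\<close>

abbreviation supp :: "('n::finite) real_mpoly \<Rightarrow> (nat ^ 'n) set" where
  "supp f \<equiv> Poly_Mapping.keys f"

definition real_vec :: "nat ^ 'n \<Rightarrow> real ^ 'n" where
  "real_vec a = (\<chi> i. real (a $ i))"

definition newton :: "('n::finite) real_mpoly \<Rightarrow> (real ^ 'n) set" where
  "newton f = convex hull (real_vec ` supp f)"

definition saturated_newton :: "('n::finite) real_mpoly \<Rightarrow> bool" where
  "saturated_newton f \<longleftrightarrow> real_vec ` supp f = newton f \<inter> {x. \<forall>i. x $ i \<in> \<int>}"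

text \<open>The bijections \<open>s\<close> run over all ways of placing \<open>la\<^sub>0, \<dots>, la\<^sub>n\<^sub>-\<^sub>1\<close> (padded with
  zeros) into the \<open>n\<close> coordinates. Meaningful only if \<open>la\<close> has at most \<open>n\<close> parts.\<close>

definition permutohedron :: "nat list \<Rightarrow> (real ^ 'n::finite) set" where
  "permutohedron la = convex hull
     {(\<chi> i. real (part la (s i))) | s. bij_betw s (UNIV :: 'n set) {..<CARD('n)}}"

definition M_convex :: "('n::finite) real_mpoly \<Rightarrow> bool" where
  "M_convex f \<longleftrightarrow> (\<forall>a \<in> supp f. \<forall>b \<in> supp f. \<forall>i. a $ i > b $ i \<longrightarrow>
     (\<exists>j. a $ j < b $ j \<and> a - axis i 1 + axis j 1 \<in> supp f))"

end

theory Submission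
  imports Defs
begin

text \<open>Every semistandard filling of the core of \<open>\<mu>\<close> has at least \<open>\<bar>\<mu>\<bar>\<close> distinct pairs
  (letter, residue). The \<open>k\<close>-tableaux are exactly the fillings that attain this bound, and everything
  else follows from this minimality.

  Deleting bottom rows of a core leaves a core, so the bound shows that the \<open>i\<close> largest letters have
  total weight at most \<open>\<mu>\<^sub>1 + \<dots> + \<mu>\<^sub>i\<close>; filling each column downwards with the largest letters
  attains all these bounds at once. As \<open>f\<close> is symmetric, its support lies in the permutohedron of
  \<open>\<lambda>\<close> and contains the vertices, where only \<open>\<mu> = \<lambda>\<close> contributes.

  If the coefficients are nonnegative, let \<open>a\<close> be in the support with \<open>a\<^sub>i \<ge> a\<^sub>j + 2\<close>. By symmetry \<open>i\<close>
  and \<open>j\<close> may be taken to be the two smallest letters. Changing one entry of a \<open>k\<close>-tableau from \<open>i\<close>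
  to \<open>j\<close> then moves one unit of weight, since minimality forbids losing it. Such
  transfers reach every lattice point of the permutohedron (Muirhead), and these lattice points
  satisfy the exchange property.\<close>

section \<open>Cores and beads\<close>

text \<open>The beta numbers of a partition: the content of the place just after the last cell of
  row \<open>r\<close>. Empty rows give beads too, so all sufficiently low places are
  occupied.\<close>

definition bead :: "(nat \<Rightarrow> nat) \<Rightarrow> nat \<Rightarrow> int" where
  "bead g r = int (g r) - int r"

text \<open>Here \<open>g\<close> gives the row lengths of a \<open>(k + 1)\<close>-core and \<open>u\<close> the numbers of cells of hook
  length at most \<open>k\<close>. The recursion says that the bead \<open>k + 1\<close> places below that of row \<open>r\<close> is the
  bead of row \<open>r + 1 + k - u r\<close>: the \<open>k\<close> places in between hold \<open>u r\<close> gaps and \<open>k - u r\<close> beads.\<close>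

definition bounded_core :: "nat \<Rightarrow> (nat \<Rightarrow> nat) \<Rightarrow> (nat \<Rightarrow> nat) \<Rightarrow> bool" where
  "bounded_core k g u \<longleftrightarrow> antimono g \<and> (\<exists>L. \<forall>r\<ge>L. g r = 0) \<and>
     (\<forall>r. u r \<le> k \<and> g r = u r + g (r + 1 + k - u r))"

lemma bounded_coreD:
  assumes "bounded_core k g u"
  shows "antimono g" "u r \<le> k" "g r = u r + g (r + 1 + k - u r)"
  using assms unfolding bounded_core_def by blast+

lemma bead_less: "antimono g \<Longrightarrow> r < s \<Longrightarrow> bead g s < bead g r"
  unfolding bead_def using antimonoD[of g r s] by auto

lemma bead_less_iff: "antimono g \<Longrightarrow> bead g s < bead g r \<longleftrightarrow> r < s"
  by (metis bead_less linorder_neqE_nat order_less_asym')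

lemma bead_eq_iff: "antimono g \<Longrightarrow> bead g s = bead g r \<longleftrightarrow> s = r"
  by (metis bead_less linorder_neqE_nat order_less_irrefl)

text \<open>Beads decrease strictly with the row, so only the bead of the next row can sit directly
  left of a given one. A gap there marks a removable corner.\<close>

lemma bead_pred_iff:
  assumes "antimono g"
  shows "bead g r - 1 \<in> range (bead g) \<longleftrightarrow> g (Suc r) = g r"
proof
  assume "bead g r - 1 \<in> range (bead g)"
  then obtain s where s: "bead g s = bead g r - 1" by force
  then have "r < s" using bead_less_iff[OF assms, of s r] by simp
  then have "bead g s \<le> bead g (Suc r)"
    using bead_less_iff[OF assms, of "Suc r" s] by simp
  moreover have "bead g (Suc r) < bead g r" by (rule bead_less[OF assms]) simp
  ultimately show "g (Suc r) = g r" using s by (simp add: bead_def)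
next
  assume "g (Suc r) = g r"
  then have "bead g r - 1 = bead g (Suc r)" by (simp add: bead_def)
  then show "bead g r - 1 \<in> range (bead g)" by simp
qed

lemma bounded_core_bead:
  assumes "bounded_core k g u"
  shows "bead g (r + 1 + k - u r) = bead g r - int (k + 1)"
  using bounded_coreD(2,3)[OF assms, of r] by (simp add: bead_def)

text \<open>The abacus description of a core: beads are flush on every runner. Each step down by
  \<open>k + 1\<close> is one use of the recursion.\<close>

lemma bead_closed:
  assumes "bounded_core k g u" "p \<in> range (bead g)"
  shows "p - int t * int (k + 1) \<in> range (bead g)"
proof (induction t)
  case 0
  then show ?case using assms(2) by simp
next
  case (Suc t)
  then obtain r where "bead g r = p - int t * int (k + 1)" by force
  then have "bead g (r + 1 + k - u r) = p - int (Suc t) * int (k + 1)"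
    unfolding bounded_core_bead[OF assms(1)] by (simp add: algebra_simps)
  then show ?case by (metis rangeI)
qed

lemma bead_closed':
  assumes "bounded_core k g u" "p \<in> range (bead g)" "p' \<le> p" "p' mod int (k + 1) = p mod int (k + 1)"
  shows "p' \<in> range (bead g)"
proof -
  have "int (k + 1) dvd p - p'" using assms(4) by (metis mod_eq_dvd_iff)
  then obtain q where q: "p - p' = int (k + 1) * q" by blast
  then have "q \<ge> 0" using assms(3) by (metis diff_ge_0_iff_ge int_nat_eq of_nat_0_less_iff of_nat_mult zero_le_mult_iff add_gr_0 zero_less_one not_le)
  then have "p' = p - int (nat q) * int (k + 1)" using q by (simp add: algebra_simps)
  then show ?thesis using bead_closed[OF assms(1,2)] by metis
qed

text \<open>The recursion at a row refers only to higher rows, and only by relative position, so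
  deleting bottom rows preserves it.\<close>

lemma bounded_core_shift:
  assumes "bounded_core k g u"
  shows "bounded_core k (\<lambda>r. g (r + i)) (\<lambda>r. u (r + i))"
proof -
  obtain L where L: "\<forall>r\<ge>L. g r = 0" using assms unfolding bounded_core_def by blast
  have a: "antimono (\<lambda>r. g (r + i))"
    using bounded_coreD(1)[OF assms] by (auto simp: antimono_def)
  have "u (r + i) \<le> k \<and> g (r + i) = u (r + i) + g (r + 1 + k - u (r + i) + i)" for r
    using bounded_coreD(2,3)[OF assms, of "r + i"] by (simp add: algebra_simps)
  then show ?thesis unfolding bounded_core_def using a L by (metis trans_le_add1)
qed

text \<open>Removes all removable corners of one residue: \<open>dec r\<close> says that row \<open>r\<close> ends in such a corner.
  Only the topmost of these rows loses a cell of hook length at most \<open>k\<close>.\<close>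

lemma core_remove_residue:
  fixes w :: int
  assumes core: "bounded_core k g u" and k: "k \<ge> 1"
  defines "dec \<equiv> (\<lambda>r. bead g r mod int (k + 1) = w \<and> g (Suc r) < g r)"
  defines "g1 \<equiv> (\<lambda>r. if dec r then g r - 1 else g r)"
  shows "\<exists>u1. bounded_core k g1 u1 \<and> (\<Sum>r<L. u r) \<le> (\<Sum>r<L. u1 r) + 1"
proof -
  note mono = bounded_coreD(1)[OF core]
  define sh where "sh r = r + 1 + k - u r" for r
  have ule: "u r \<le> k" for r using bounded_coreD(2)[OF core] .
  have shb: "bead g (sh r) = bead g r - int (k + 1)" for r
    unfolding sh_def using bounded_core_bead[OF core] .
  have gsh: "g r = u r + g (sh r)" for r
    unfolding sh_def using bounded_coreD(3)[OF core] .
  have dec_iff: "dec r \<longleftrightarrow> bead g r mod int (k + 1) = w \<and> bead g r - 1 \<notin> range (bead g)" for r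
    unfolding dec_def bead_pred_iff[OF mono] using antimonoD[OF mono, of r "Suc r"] by auto
  have mod_sh: "bead g (sh r) mod int (k + 1) = bead g r mod int (k + 1)" for r
    unfolding shb by (metis mod_diff_right_eq diff_zero mod_self)
  \<comment> \<open>A bead directly left of that of row \<open>r\<close> would put one directly left
    of that of row \<open>sh r\<close>.\<close>
  have dec_sh: "dec r" if "dec (sh r)" for r
  proof -
    have False if "bead g r - 1 \<in> range (bead g)"
    proof -
      have "bead g (sh r) - 1 \<in> range (bead g)"
        using bead_closed[OF core that, of 1] by (simp add: shb algebra_simps)
      then show False using \<open>dec (sh r)\<close> dec_iff by simp
    qed
    then show ?thesis using that mod_sh dec_iff by metis
  qed
  \<comment> \<open>These are the rows that lose a cell while row \<open>sh r\<close> does not; only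
    there does \<open>u\<close> drop.\<close>
  define ex where "ex r \<longleftrightarrow> dec r \<and> \<not> dec (sh r)" for r
  have ex_u: "u r \<ge> 1" if "ex r" for r
  proof (rule ccontr)
    assume "\<not> u r \<ge> 1"
    then have "g r = g (sh r)" "Suc r \<le> sh r" using gsh[of r] by (auto simp: sh_def)
    then have "g r \<le> g (Suc r)" using antimonoD[OF mono, of "Suc r" "sh r"] by simp
    then show False using that by (simp add: ex_def dec_def)
  qed
  \<comment> \<open>Of two such beads the lower lies at least \<open>k + 1\<close> below the other.
    The occupied place before the bead of \<open>sh r'\<close> then fills the place before the lower
    bead.\<close>
  have ex_unique: "r = r'" if "ex r" "ex r'" for r r'
  proof -
    have *: False if "ex r" "ex r'" "bead g r < bead g r'" for r r'
    proof -
      have w: "bead g r mod int (k + 1) = w" "bead g r' mod int (k + 1) = w"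
        using that by (auto simp: ex_def dec_def)
      have "bead g (sh r') - 1 \<in> range (bead g)"
        using that(2) w(2) mod_sh unfolding ex_def dec_iff by metis
      moreover have "int (k + 1) dvd bead g r' - bead g r" using w by (metis mod_eq_dvd_iff)
      then have "int (k + 1) \<le> bead g r' - bead g r" using that(3) by (intro zdvd_imp_le) auto
      then have "bead g r - 1 \<le> bead g (sh r') - 1" unfolding shb by simp
      moreover have "(bead g r - 1) mod int (k + 1) = (bead g (sh r') - 1) mod int (k + 1)"
        using w mod_sh[of r'] by (metis mod_diff_left_eq)
      ultimately have "bead g r - 1 \<in> range (bead g)" using bead_closed'[OF core] by blast
      then show False using that(1) unfolding ex_def dec_iff by blast
    qed
    have "bead g r = bead g r'" using * that by (metis linorder_neqE)
    then show ?thesis using bead_eq_iff[OF mono] by blast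
  qed
  define u1 where "u1 r = (if ex r then u r - 1 else u r)" for r
  have anti: "antimono g1"
  proof (rule decseq_SucI)
    fix r show "g1 (Suc r) \<le> g1 r"
      using antimonoD[OF mono, of r "Suc r"] by (auto simp: g1_def dec_def)
  qed
  have step: "g1 r = u1 r + g1 (r + 1 + k - u1 r)" for r
  proof (cases "dec r")
    case False
    then show ?thesis using dec_sh[of r] gsh[of r] by (auto simp: u1_def ex_def g1_def sh_def)
  next
    case True
    show ?thesis
    proof (cases "dec (sh r)")
      case True
      then have "g (sh r) \<ge> 1" by (auto simp: dec_def)
      then show ?thesis using True \<open>dec r\<close> gsh[of r] by (auto simp: u1_def ex_def g1_def sh_def)
    next
      case False
      then have ex: "ex r" using \<open>dec r\<close> by (simp add: ex_def)
      \<comment> \<open>Lowering \<open>u r\<close> by one points the recursion at the row after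
        \<open>sh r\<close>, which is shown to have the same length and to lose nothing.\<close>
      have idx: "r + 1 + k - u1 r = Suc (sh r)"
        using ex ex_u[OF ex] ule[of r] by (auto simp: u1_def sh_def)
      have "bead g (sh r) mod int (k + 1) = w" using mod_sh \<open>dec r\<close> by (simp add: dec_def)
      then have gs: "g (Suc (sh r)) = g (sh r)"
        using False antimonoD[OF mono, of "sh r" "Suc (sh r)"] by (auto simp: dec_def)
      have "bead g (Suc (sh r)) mod int (k + 1) \<noteq> w"
      proof
        assume "bead g (Suc (sh r)) mod int (k + 1) = w"
        then have "int (k + 1) dvd bead g (sh r) - bead g (Suc (sh r))"
          using \<open>bead g (sh r) mod int (k + 1) = w\<close> by (metis mod_eq_dvd_iff)
        then have "int (k + 1) dvd 1" using gs by (simp add: bead_def)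
        then show False using k by auto
      qed
      then have "\<not> dec (Suc (sh r))" by (simp add: dec_def)
      then show ?thesis unfolding idx
        using \<open>dec r\<close> ex ex_u[OF ex] gs gsh[of r] by (auto simp: u1_def g1_def)
    qed
  qed
  obtain L0 where "\<forall>r\<ge>L0. g r = 0" using core unfolding bounded_core_def by blast
  then have "\<forall>r\<ge>L0. g1 r = 0" by (simp add: g1_def)
  moreover have "u1 r \<le> k" for r using ule[of r] by (auto simp: u1_def)
  ultimately have "bounded_core k g1 u1" unfolding bounded_core_def using anti step by blast
  moreover have "(\<Sum>r<L. u r) \<le> (\<Sum>r<L. u1 r) + 1"
  proof -
    have "(\<Sum>r<L. u r) \<le> (\<Sum>r<L. u1 r + of_bool (ex r))"
      by (rule sum_mono) (auto simp: u1_def)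
    also have "\<dots> = (\<Sum>r<L. u1 r) + card {r\<in>{..<L}. ex r}"
      by (simp add: sum.distrib of_bool_def sum.If_cases Int_def)
    also have "card {r\<in>{..<L}. ex r} \<le> 1"
      using ex_unique card_le_Suc0_iff_eq[of "{r\<in>{..<L}. ex r}"] by auto
    finally show ?thesis by simp
  qed
  ultimately show ?thesis by blast
qed

section \<open>A lower bound for the number of pairs of a letter and a residue\<close>

definition cells :: "(nat \<Rightarrow> nat) \<Rightarrow> (nat \<times> nat) set" where
  "cells g = {(i, j). j < g i}"

definition semistandard :: "(nat \<Rightarrow> nat) \<Rightarrow> (nat \<times> nat \<Rightarrow> 'a::linorder) \<Rightarrow> bool" where
  "semistandard g T \<longleftrightarrow>
     (\<forall>i j j'. j < j' \<and> (i, j') \<in> cells g \<longrightarrow> T (i, j) \<le> T (i, j')) \<and>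
     (\<forall>i i' j. i < i' \<and> (i', j) \<in> cells g \<longrightarrow> T (i, j) < T (i', j))"

text \<open>The cardinality of this set is the total \<open>k\<close>-weight of the filling.\<close>

definition letter_residues ::
    "nat \<Rightarrow> (nat \<Rightarrow> nat) \<Rightarrow> (nat \<times> nat \<Rightarrow> 'a) \<Rightarrow> ('a \<times> int) set" where
  "letter_residues k g T = (\<lambda>c. (T c, residue (k + 1) c)) ` cells g"

lemma finite_cells:
  assumes "antimono g" "\<forall>r\<ge>L. g r = 0"
  shows "finite (cells g)"
proof (rule finite_subset)
  show "cells g \<subseteq> {..<L} \<times> {..<g 0}"
  proof clarify
    fix i j assume "(i, j) \<in> cells g"
    then have "j < g i" by (simp add: cells_def)
    moreover have "i < L" using assms(2) calculation by (metis not_le not_less_zero)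
    moreover have "g i \<le> g 0" using antimonoD[OF assms(1), of 0 i] by simp
    ultimately show "i \<in> {..<L} \<and> j \<in> {..<g 0}" by simp
  qed
qed simp

lemma semistandard_subset:
  "semistandard g T \<Longrightarrow> cells h \<subseteq> cells g \<Longrightarrow> semistandard h T"
  unfolding semistandard_def by blast

lemma residue_Suc: "residue m (i, j + 1) = (residue m (i, j) + 1) mod int m"
  unfolding residue.simps mod_add_left_eq by (simp add: algebra_simps)

lemma residues_closed_under_Suc:
  assumes "m > 0" "R \<subseteq> {0..<int m}" "R \<noteq> {}" "\<And>v. v \<in> R \<Longrightarrow> (v + 1) mod int m \<in> R"
  shows "R = {0..<int m}"
proof
  obtain v0 where v0: "v0 \<in> R" using assms(3) by blast
  have *: "(v0 + int t) mod int m \<in> R" for t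
  proof (induction t)
    case 0
    then show ?case using v0 assms(2) by auto
  next
    case (Suc t)
    have "(v0 + int (Suc t)) mod int m = ((v0 + int t) mod int m + 1) mod int m"
      by (simp only: mod_add_left_eq) (simp add: algebra_simps)
    then show ?case using assms(4)[OF Suc] by simp
  qed
  show "{0..<int m} \<subseteq> R"
  proof
    fix w assume w: "w \<in> {0..<int m}"
    have "v0 \<in> {0..<int m}" using v0 assms(2) by blast
    then have "(v0 + int (nat (w - v0 + int m))) mod int m = (w + int m) mod int m"
      using w by (intro arg_cong2[where f = "(mod)"]) auto
    also have "\<dots> = w" using w by simp
    finally show "w \<in> R" using * by metis
  qed
qed (use assms in blast)

text \<open>Let \<open>x\<close> be the largest letter. If it occurs with residue \<open>v\<close> but not with \<open>v + 1\<close>, all its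
  cells of residue \<open>v\<close> are removable corners, and removing the corners of this residue costs at
  least one pair and at most one unit of size. If it occurs with all \<open>k + 1\<close> residues, the core
  formed by the other rows, placed at the bottom, contains no \<open>x\<close>, and its size is smaller by at
  most \<open>k\<close>.\<close>

lemma core_size_le_letter_residues:
  fixes T :: "nat \<times> nat \<Rightarrow> 'a::linorder"
  assumes "bounded_core k g u" "k \<ge> 1" "semistandard g T" "\<forall>r\<ge>L. g r = 0"
  shows "(\<Sum>r<L. u r) \<le> card (letter_residues k g T)"
  using assms(1,3,4)
\<comment> \<open>Induction on the number of cells; \<open>T\<close> and \<open>L\<close> stay fixed
  while the diagram shrinks.\<close>
proof (induction "\<Sum>r<L. g r" arbitrary: g u rule: less_induct)
  case (less g u)
  note core = less.prems(1) and ss = less.prems(2) and L = less.prems(3)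
  note mono = bounded_coreD(1)[OF core]
  have fin: "finite (cells g)" using finite_cells[OF mono L] .
  have finLR: "finite (letter_residues k g T)" by (simp add: letter_residues_def fin)
  show ?case
  proof (cases "g 0 = 0")
    case True
    then have "g r = 0" for r using antimonoD[OF mono, of 0 r] by simp
    then have "u r = 0" for r using bounded_coreD(3)[OF core, of r] by simp
    then show ?thesis by simp
  next
    case False
    then have "(0, 0) \<in> cells g" by (simp add: cells_def)
    define x where "x = Max (T ` cells g)"
    have x_max: "T c \<le> x" if "c \<in> cells g" for c
      unfolding x_def using that fin by simp
    have x_in: "x \<in> T ` cells g"
      unfolding x_def using fin \<open>(0, 0) \<in> cells g\<close> by (intro Max_in) auto
    define R where "R = residue (k + 1) ` {c \<in> cells g. T c = x}"
    have "0 < L" using False L by (metis gr0I order_refl)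
    have R_sub: "R \<subseteq> {0..<int (k + 1)}" unfolding R_def by auto
    have R_ne: "R \<noteq> {}" using x_in by (auto simp: R_def)
    show ?thesis
    proof (cases "\<forall>v\<in>R. (v + 1) mod int (k + 1) \<in> R")
      case True
      have R: "R = {0..<int (k + 1)}"
        using True R_sub R_ne by (intro residues_closed_under_Suc) auto
      define h where "h r = g (r + 1)" for r
      have coreh: "bounded_core k h (\<lambda>r. u (r + 1))"
        unfolding h_def by (rule bounded_core_shift[OF core])
      have sub: "cells h \<subseteq> cells g"
        using antimonoD[OF mono le_SucI[OF order_refl]] unfolding cells_def h_def
        by (auto intro: less_le_trans)
      have Tless: "T c < x" if "c \<in> cells h" for c
      proof -
        obtain i j where c: "c = (i, j)" by force
        then have "(i + 1, j) \<in> cells g" using that by (simp add: cells_def h_def)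
        then have "T (i, j) < T (i + 1, j)" using ss unfolding semistandard_def by auto
        also have "\<dots> \<le> x" using \<open>(i + 1, j) \<in> cells g\<close> by (rule x_max)
        finally show ?thesis using c by simp
      qed
      have sumg: "(\<Sum>r<L. f (r + 1)) + f 0 = (\<Sum>r<L. f r) + f L" for f :: "nat \<Rightarrow> nat"
        using sum.lessThan_Suc_shift[of f L] by simp
      have "(\<Sum>r<L. h r) < (\<Sum>r<L. g r)"
        using sumg[of g] False L by (simp add: h_def)
      moreover have "\<forall>r\<ge>L. h r = 0" using L by (simp add: h_def)
      ultimately have IH: "(\<Sum>r<L. u (r + 1)) \<le> card (letter_residues k h T)"
        using less.hyps[OF _ coreh semistandard_subset[OF ss sub]] by blast
      have "letter_residues k h T \<inter> {x} \<times> R = {}"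
        using Tless by (force simp: letter_residues_def)
      moreover have "letter_residues k h T \<subseteq> letter_residues k g T"
        using sub unfolding letter_residues_def by blast
      moreover have "{x} \<times> R \<subseteq> letter_residues k g T"
        unfolding R_def letter_residues_def by auto
      ultimately have "card (letter_residues k h T) + card ({x} \<times> R) \<le> card (letter_residues k g T)"
        using finLR by (metis Un_least card_Un_disjoint card_mono finite_subset)
      moreover have "card ({x} \<times> R) = k + 1" by (simp add: R card_cartesian_product)
      moreover have "u 0 \<le> k" by (rule bounded_coreD(2)[OF core])
      ultimately show ?thesis using sumg[of u] IH by linarith
    next
      case False
      then obtain v where v: "v \<in> R" "(v + 1) mod int (k + 1) \<notin> R" by blast
      \<comment> \<open>A row ending in a cell of residue \<open>v\<close> has a bead of residue
        \<open>v + 1\<close>, the bead being the content of the next place.\<close>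
      define dec where "dec r \<longleftrightarrow> bead g r mod int (k + 1) = (v + 1) mod int (k + 1) \<and> g (Suc r) < g r" for r
      define g1 where "g1 r = (if dec r then g r - 1 else g r)" for r
      obtain u1 where core1: "bounded_core k g1 u1" and le: "(\<Sum>r<L. u r) \<le> (\<Sum>r<L. u1 r) + 1"
        using core_remove_residue[OF core \<open>k \<ge> 1\<close>, of "(v + 1) mod int (k + 1)" L]
        unfolding g1_def dec_def by blast
      have sub: "cells g1 \<subseteq> cells g" by (auto simp: cells_def g1_def split: if_splits)
      have removed: "dec i \<and> j = g i - 1"
        if c: "(i, j) \<in> cells g" "T (i, j) = x" "residue (k + 1) (i, j) = v" for i j
      proof -
        have "(i, j + 1) \<notin> cells g"
        proof
          assume a: "(i, j + 1) \<in> cells g"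
          then have "T (i, j) \<le> T (i, j + 1)" using ss unfolding semistandard_def by auto
          then have "T (i, j + 1) = x" using x_max[OF a] c(2) by simp
          then have "residue (k + 1) (i, j + 1) \<in> R" using a unfolding R_def by blast
          moreover have "residue (k + 1) (i, j + 1) = (v + 1) mod int (k + 1)"
            unfolding c(3)[symmetric] by (rule residue_Suc)
          ultimately show False using v by simp
        qed
        then have j: "g i = j + 1" using c(1) by (auto simp: cells_def)
        have "(i + 1, j) \<notin> cells g"
        proof
          assume a: "(i + 1, j) \<in> cells g"
          then have "T (i, j) < T (i + 1, j)" using ss unfolding semistandard_def by auto
          then show False using x_max[OF a] c(2) by simp
        qed
        then have "g (Suc i) < g i" using j by (auto simp: cells_def)
        moreover have "bead g i mod int (k + 1) = (v + 1) mod int (k + 1)"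
          unfolding c(3)[symmetric] residue_Suc[symmetric] bead_def j by simp
        ultimately show ?thesis using j by (simp add: dec_def)
      qed
      obtain i j where ij: "(i, j) \<in> cells g" "T (i, j) = x" "residue (k + 1) (i, j) = v"
        using v(1) unfolding R_def by auto
      have "dec i" using removed[OF ij] by simp
      have "i < L" using ij(1) L unfolding cells_def by (auto simp: not_le[symmetric])
      have "(\<Sum>r<L. g1 r) < (\<Sum>r<L. g r)"
      proof (rule sum_strict_mono_ex1)
        show "finite {..<L}" by simp
        show "\<forall>r\<in>{..<L}. g1 r \<le> g r" by (simp add: g1_def)
        show "\<exists>r\<in>{..<L}. g1 r < g r" using \<open>dec i\<close> \<open>i < L\<close> ij(1)
          by (intro bexI[of _ i]) (auto simp: g1_def cells_def)
      qed
      moreover have "\<forall>r\<ge>L. g1 r = 0" using L by (simp add: g1_def)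
      ultimately have IH: "(\<Sum>r<L. u1 r) \<le> card (letter_residues k g1 T)"
        using less.hyps[OF _ core1 semistandard_subset[OF ss sub]] by blast
      have "(x, v) \<in> letter_residues k g T"
        using ij unfolding letter_residues_def by (force simp del: residue.simps)
      moreover have "(x, v) \<notin> letter_residues k g1 T"
      proof
        assume "(x, v) \<in> letter_residues k g1 T"
        then obtain i j where c: "(i, j) \<in> cells g1" "T (i, j) = x" "residue (k + 1) (i, j) = v"
          unfolding letter_residues_def by (auto simp del: residue.simps)
        then have "dec i \<and> j = g i - 1" using removed sub by blast
        then show False using c(1) by (auto simp: cells_def g1_def)
      qed
      moreover have "letter_residues k g1 T \<subseteq> letter_residues k g T"
        using sub unfolding letter_residues_def by blast
      ultimately have "letter_residues k g1 T \<subset> letter_residues k g T" by blast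
      then have "card (letter_residues k g1 T) < card (letter_residues k g T)"
        using finLR by (rule psubset_card_mono[rotated])
      then show ?thesis using IH le by linarith
    qed
  qed
qed

section \<open>The core of a bounded partition\<close>

lemma is_partition_antimono:
  assumes "is_partition mu"
  shows "antimono (part mu)"
proof (rule antimonoI)
  fix i j :: nat assume "i \<le> j"
  show "part mu j \<le> part mu i"
  proof (cases "j < length mu \<and> i \<noteq> j")
    case True
    then have "mu ! i \<ge> mu ! j"
      using assms \<open>i \<le> j\<close> unfolding is_partition_def by (simp add: sorted_wrt_iff_nth_less)
    then show ?thesis using True \<open>i \<le> j\<close> by (simp add: nth_default_def)
  next
    case False
    then show ?thesis by (auto simp: nth_default_def)
  qed
qed

lemma is_partition_part_pos: "is_partition mu \<Longrightarrow> 0 < part mu i \<longleftrightarrow> i < length mu"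
  unfolding is_partition_def by (auto simp: nth_default_def in_set_conv_nth intro: gr0I)

lemma part_zero: "length mu \<le> i \<Longrightarrow> part mu i = 0"
  by (simp add: nth_default_def)

lemma is_partition_eqI:
  assumes "is_partition mu" "is_partition la" "part mu = part la"
  shows "mu = la"
proof -
  have "i < length mu \<longleftrightarrow> i < length la" for i
    using assms is_partition_part_pos by metis
  then have len: "length mu = length la" by (metis linorder_neqE_nat order_less_irrefl)
  then show ?thesis
    by (intro nth_equalityI) (metis assms(3) nth_default_nth)+
qed

lemma is_partition_map_upt:
  assumes "antimono g" "\<And>r. r < L \<Longrightarrow> 0 < g r"
  shows "is_partition (map g [0..<L])"
  using assms unfolding is_partition_def
  by (auto simp: sorted_wrt_iff_nth_less dest: antimonoD[OF assms(1) less_imp_le])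
    (metis less_irrefl)

lemma part_map_upt: "\<forall>r\<ge>L. g r = 0 \<Longrightarrow> part (map g [0..<L]) = g"
  by (auto simp: nth_default_def)

lemma diagram_eq_cells: "diagram g = cells (part g)"
  by (simp add: diagram_def cells_def)

section \<open>Column lengths, hook lengths and the bead recursion\<close>

definition height :: "(nat \<Rightarrow> nat) \<Rightarrow> nat \<Rightarrow> nat" where
  "height g j = card {i. j < g i}"

lemma less_height_iff:
  assumes "antimono g" "\<forall>r\<ge>L. g r = 0"
  shows "i < height g j \<longleftrightarrow> j < g i"
proof -
  define n where "n = (LEAST i. \<not> j < g i)"
  have ex: "\<not> j < g L" using assms(2) by simp
  have "{i. j < g i} = {..<n}"
  proof (rule set_eqI)
    fix i
    have "\<not> j < g n" unfolding n_def by (rule LeastI[of "\<lambda>i. \<not> j < g i", OF ex])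
    moreover have "g i \<le> g n" if "n \<le> i" using antimonoD[OF assms(1) that] .
    moreover have "j < g i" if "i < n" using not_less_Least[of i "\<lambda>i. \<not> j < g i"] that n_def by blast
    ultimately show "i \<in> {i. j < g i} \<longleftrightarrow> i \<in> {..<n}" by (meson lessThan_iff mem_Collect_eq not_le order_less_le_trans)
  qed
  then have "height g j = n" "j < g i \<longleftrightarrow> i < n" unfolding height_def by auto
  then show ?thesis by simp
qed

text \<open>Column \<open>j\<close> owns the gap at
  \<open>int j - int (height (part g) j) + 1\<close>, so hook lengths are distances from beads down
  to gaps.\<close>

lemma int_hook_length:
  assumes "is_partition g" "j < part g i"
  shows "int (hook_length g (i, j)) = bead (part g) i - (int j - int (height (part g) j) + 1)"
proof -
  note h = less_height_iff[OF is_partition_antimono[OF assms(1)], of "length g"]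
  have "{j'. j < j' \<and> (i, j') \<in> diagram g} = {j<..<part g i}" by (auto simp: diagram_def)
  moreover have "{i'. i < i' \<and> (i', j) \<in> diagram g} = {i<..<height (part g) j}"
    using h by (auto simp: diagram_def part_zero)
  moreover have "i < height (part g) j" using h assms(2) by (simp add: part_zero)
  ultimately show ?thesis using assms(2) by (simp add: bead_def)
qed

text \<open>The bead of row \<open>s = i + 1 + k - u i\<close> lies exactly \<open>k + 1\<close>
  below that of row \<open>i\<close>. No gap can be there, and the gap of a column lies above this
  place exactly when row \<open>s\<close> does not reach the column.\<close>

lemma hook_length_bounded_core:
  assumes "is_partition g" and core: "bounded_core k (part g) u" and j: "j < part g i"
  shows "hook_length g (i, j) \<le> k \<longleftrightarrow> part g i - u i \<le> j"
    and "hook_length g (i, j) \<noteq> k + 1"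
proof -
  note h = less_height_iff[OF is_partition_antimono[OF assms(1)], of "length g"]
  define s where "s = i + 1 + k - u i"
  have gs: "part g i = u i + part g s" "u i \<le> k"
    unfolding s_def using bounded_coreD(2,3)[OF core, of i] by auto
  show "hook_length g (i, j) \<le> k \<longleftrightarrow> part g i - u i \<le> j" "hook_length g (i, j) \<noteq> k + 1"
    using int_hook_length[OF assms(1) j] h[of s j] gs j
    by (auto simp: bead_def part_zero s_def of_nat_diff)
qed

text \<open>If the place \<open>k + 1\<close> below a bead were a gap, the column owning it would
  meet that row in a cell of hook length \<open>k + 1\<close>.\<close>

lemma is_core_bounded_core:
  assumes "is_core (k + 1) g"
  shows "\<exists>u. bounded_core k (part g) u"
proof -
  have part: "is_partition g" and hooks: "\<And>i j. j < part g i \<Longrightarrow> hook_length g (i, j) \<noteq> k + 1"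
    using assms by (auto simp: is_core_def diagram_def)
  note mono = is_partition_antimono[OF part]
  note h = less_height_iff[OF mono, of "length g"]
  have "\<exists>v\<le>k. part g r = v + part g (r + 1 + k - v)" for r
  proof -
    let ?b = "bead (part g)"
    let ?P = "\<lambda>s. ?b s \<le> ?b r - int (k + 1)"
    have ex: "?P (length g + r + k + 1)" by (simp add: bead_def part_zero)
    define s where "s = (LEAST s. ?P s)"
    have s: "?P s" unfolding s_def by (rule LeastI[of ?P, OF ex])
    have "r < s" using bead_less_iff[OF mono, of s r] s by simp
    then obtain q where q: "s = Suc q" "r \<le> q" by (cases s) auto
    have nq: "\<not> ?P q" using not_less_Least[of q ?P] q(1) unfolding s_def by simp
    have gq: "part g q \<le> part g r" using antimonoD[OF mono q(2)] .
    have "?b s = ?b r - int (k + 1)"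
    proof (rule ccontr)
      assume "?b s \<noteq> ?b r - int (k + 1)"
      then have lt: "int (part g s) - int s < ?b r - int (k + 1)" using s by (simp add: bead_def)
      \<comment> \<open>The column whose gap is the place in question; its height is
        \<open>s\<close> because \<open>s\<close> is the first row with a bead at or below that
        place.\<close>
      define j where "j = nat (?b r - int (k + 1) + int s - 1)"
      have j: "int j = ?b r - int (k + 1) + int s - 1" using lt unfolding j_def by simp
      have "j < part g q" using nq j q(1) by (simp add: bead_def)
      moreover have "\<not> j < part g s" using lt j by simp
      ultimately have "height (part g) j = s" using h[of q j] h[of s j] q(1) by (simp add: part_zero)
      then have "int (hook_length g (r, j)) = int (k + 1)"
        using int_hook_length[OF part, of j r] \<open>j < part g q\<close> gq j by simp
      then show False using hooks[of j r] \<open>j < part g q\<close> gq by simp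
    qed
    moreover have "part g s \<le> part g r" using antimonoD[OF mono, of r s] \<open>r < s\<close> by simp
    ultimately have "part g r - part g s \<le> k" "s = r + 1 + k - (part g r - part g s)"
      using \<open>r < s\<close> by (auto simp: bead_def)
    then show ?thesis using \<open>part g s \<le> part g r\<close>
      by (intro exI[of _ "part g r - part g s"]) simp
  qed
  then obtain u where "\<forall>r. u r \<le> k \<and> part g r = u r + part g (r + 1 + k - u r)" by metis
  then show ?thesis unfolding bounded_core_def using mono part_zero by blast
qed

lemma card_short_hooks:
  assumes "is_partition g" "bounded_core k (part g) u"
  shows "card {j. (i, j) \<in> diagram g \<and> hook_length g (i, j) \<le> k} = u i"
proof -
  have "{j. (i, j) \<in> diagram g \<and> hook_length g (i, j) \<le> k} = {part g i - u i..<part g i}"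
    using hook_length_bounded_core(1)[OF assms] by (auto simp: diagram_def simp del: hook_length.simps)
  then show ?thesis using bounded_coreD(3)[OF assms(2), of i] by simp
qed

section \<open>Existence and uniqueness of the core with prescribed row counts\<close>

lemma bounded_core_zero:
  assumes core: "bounded_core k g u" and "\<forall>r\<ge>L. u r = 0" "L \<le> r"
  shows "g r = 0"
proof -
  have step: "g r \<le> g (Suc r)" if "L \<le> r" for r
    using bounded_coreD(3)[OF core, of r] assms(2) that
      antimonoD[OF bounded_coreD(1)[OF core], of "Suc r" "r + 1 + k"] by simp
  have "g r \<le> g (r + n)" for n
    by (induction n) (use step assms(3) in \<open>auto intro: order_trans\<close>)
  then show ?thesis using core unfolding bounded_core_def by (metis le_add2 le_zero_eq)
qed

text \<open>The recursion computes each row from higher ones, and both sequences vanish far up, so a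
  descending induction compares them.\<close>

lemma bounded_core_unique:
  assumes core: "bounded_core k g u" "bounded_core k g' u"
  shows "g = g'"
proof
  obtain L1 L2 where "\<forall>r\<ge>L1. g r = 0" "\<forall>r\<ge>L2. g' r = 0"
    using core unfolding bounded_core_def by blast
  then have L: "g r = g' r" if "L1 + L2 \<le> r" for r using that by simp
  show "g r = g' r" for r
  proof (induction "L1 + L2 - r" arbitrary: r rule: less_induct)
    case less
    have "g (r + 1 + k - u r) = g' (r + 1 + k - u r)" if "r < L1 + L2"
      using bounded_coreD(2)[OF core(1), of r] that by (intro less) linarith
    then show ?case
      using L[of r] bounded_coreD(3)[OF core(1), of r] bounded_coreD(3)[OF core(2), of r] by force
  qed
qed

lemma bounded_core_exists:
  assumes "antimono u" "\<And>r. u r \<le> k" "\<forall>r\<ge>L. u r = 0"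
  shows "\<exists>g. bounded_core k g u"
  using assms
proof (induction L arbitrary: u)
  case 0
  then have "bounded_core k (\<lambda>_. 0) u" by (auto simp: bounded_core_def antimono_def)
  then show ?case by blast
next
  case (Suc L)
  have "antimono (\<lambda>r. u (Suc r))" using Suc.prems(1) by (simp add: antimono_def)
  then obtain h where h: "bounded_core k h (\<lambda>r. u (Suc r))"
    using Suc.IH[of "\<lambda>r. u (Suc r)"] Suc.prems by auto
  \<comment> \<open>Row \<open>Suc r\<close> of \<open>g\<close> is row \<open>r\<close> of
    \<open>h\<close>, so the index \<open>1 + k - u 0\<close> of the recursion becomes
    \<open>k - u 0\<close>.\<close>
  define g where "g r = (case r of 0 \<Rightarrow> u 0 + h (k - u 0) | Suc r \<Rightarrow> h r)" for r
  have "antimono g"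
  proof (rule decseq_SucI)
    fix r
    show "g (Suc r) \<le> g r"
    proof (cases r)
      case 0
      have "h 0 = u 1 + h (1 + k - u 1)" "u 1 \<le> u 0"
        using bounded_coreD(3)[OF h, of 0] antimonoD[OF Suc.prems(1), of 0 1] by simp_all
      moreover have "h (1 + k - u 1) \<le> h (k - u 0)"
        using \<open>u 1 \<le> u 0\<close> by (intro antimonoD[OF bounded_coreD(1)[OF h]]) simp
      ultimately show ?thesis using 0 by (simp add: g_def)
    next
      case (Suc q)
      then show ?thesis using antimonoD[OF bounded_coreD(1)[OF h], of q "Suc q"] by (simp add: g_def)
    qed
  qed
  moreover have "g r = u r + g (r + 1 + k - u r)" for r
  proof (cases r)
    case 0
    then show ?thesis using Suc.prems(2)[of 0] by (simp add: g_def Suc_diff_le)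
  next
    case (Suc q)
    have "Suc q + 1 + k - u (Suc q) = Suc (q + 1 + k - u (Suc q))"
      using Suc.prems(2)[of "Suc q"] by simp
    then show ?thesis using bounded_coreD(3)[OF h, of q] Suc by (simp add: g_def)
  qed
  moreover obtain L' where "\<forall>r\<ge>L'. h r = 0" using h unfolding bounded_core_def by blast
  then have "\<forall>r\<ge>Suc L'. g r = 0" by (auto simp: g_def split: nat.split)
  ultimately have "bounded_core k g u" unfolding bounded_core_def using Suc.prems(2) by blast
  then show ?case by blast
qed

text \<open>Resolves the definite description in \<open>core_of\<close>: the recursion supplies a
  core with the required counts, and any other such core solves the same recursion.\<close>

lemma core_of_bounded_core:
  assumes "k_bounded_partition k mu"
  shows "is_partition (core_of k mu)" "bounded_core k (part (core_of k mu)) (part mu)"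
proof -
  have part: "is_partition mu" and le: "part mu r \<le> k" for r
    using assms by (auto simp: k_bounded_partition_def nth_default_def)
  obtain g where g: "bounded_core k g (part mu)"
    using bounded_core_exists[OF is_partition_antimono[OF part] le, of "length mu"] part_zero by blast
  define gl where "gl = map g [0..<length mu]"
  have "\<forall>r\<ge>length mu. g r = 0" using bounded_core_zero[OF g] part_zero by blast
  then have gl: "part gl = g" unfolding gl_def by (rule part_map_upt)
  have glp: "is_partition gl" unfolding gl_def
  proof (rule is_partition_map_upt[OF bounded_coreD(1)[OF g]])
    fix r assume "r < length mu"
    then show "0 < g r" using bounded_coreD(3)[OF g, of r] is_partition_part_pos[OF part, of r] by simp
  qed
  let ?Q = "\<lambda>g. is_core (k + 1) g \<and>
     (\<forall>i. card {j. (i, j) \<in> diagram g \<and> hook_length g (i, j) \<le> k} = part mu i)"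
  have "core_of k mu = gl" unfolding core_of_def
  proof (rule the_equality)
    show "?Q gl"
      using glp g hook_length_bounded_core(2)[OF glp] card_short_hooks[OF glp]
      by (auto simp: is_core_def gl diagram_def simp del: hook_length.simps)
  next
    fix g' assume Q: "?Q g'"
    then obtain u where u: "bounded_core k (part g') u" using is_core_bounded_core by blast
    have g': "is_partition g'" using Q by (simp add: is_core_def)
    have "u = part mu" using Q card_short_hooks[OF g' u] by (simp add: fun_eq_iff)
    then have "part g' = part gl" using bounded_core_unique u g gl by blast
    then show "g' = gl" using is_partition_eqI g' glp by blast
  qed
  then show "is_partition (core_of k mu)" "bounded_core k (part (core_of k mu)) (part mu)"
    using glp g gl by simp_all
qed

section \<open>Weights of \<open>k\<close>-tableaux\<close>

lemma sum_part:
  assumes "length mu \<le> L"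
  shows "(\<Sum>j<L. part mu j) = sum_list mu"
proof -
  have "(\<Sum>j<L. part mu j) = (\<Sum>j<length mu. part mu j)"
    using assms by (intro sum.mono_neutral_right) (auto simp: part_zero)
  also have "\<dots> = (\<Sum>j<length mu. mu ! j)" by (intro sum.cong) (auto simp: nth_default_nth)
  also have "\<dots> = sum_list mu" by (simp add: sum_list_sum_nth lessThan_atLeast0)
  finally show ?thesis .
qed

lemma sum_lessThan_add:
  fixes f :: "nat \<Rightarrow> 'a::comm_monoid_add"
  shows "(\<Sum>j<i + n. f j) = (\<Sum>j<i. f j) + (\<Sum>j<n. f (j + i))"
  by (induction n) (simp_all add: ac_simps)

lemma ssyt_iff: "T \<in> ssyt g \<longleftrightarrow> T \<in> extensional (diagram g) \<and> semistandard (part g) T"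
  by (simp add: ssyt_def semistandard_def diagram_eq_cells)

lemma finite_diagram: "is_partition g \<Longrightarrow> finite (diagram g)"
  unfolding diagram_eq_cells using finite_cells[OF is_partition_antimono] part_zero by blast

lemma finite_k_tableaux:
  assumes "k_bounded_partition k mu"
  shows "finite (k_tableaux k mu :: (nat \<times> nat \<Rightarrow> 'n::{finite,linorder}) set)"
proof (rule finite_subset)
  show "(k_tableaux k mu :: (nat \<times> nat \<Rightarrow> 'n) set) \<subseteq> PiE (diagram (core_of k mu)) (\<lambda>_. UNIV)"
    by (auto simp: k_tableaux_def ssyt_def PiE_def)
  show "finite (PiE (diagram (core_of k mu)) (\<lambda>_. UNIV :: 'n set))"
    by (intro finite_PiE finite_diagram core_of_bounded_core(1)[OF assms]) simp
qed

lemma sum_k_weight: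
  fixes T :: "nat \<times> nat \<Rightarrow> 'n::finite"
  assumes "is_partition g"
  shows "(\<Sum>x\<in>X. k_weight k g T $ x) = card (letter_residues k (part g) T \<inter> X \<times> UNIV)"
proof -
  have "letter_residues k (part g) T \<inter> X \<times> UNIV =
      (SIGMA x:X. residue (k + 1) ` {c \<in> diagram g. T c = x})"
    unfolding letter_residues_def diagram_eq_cells by (auto simp del: residue.simps)
  then show ?thesis
    using finite_diagram[OF assms] by (simp add: k_weight_def del: residue.simps)
qed

lemma core_row_zero:
  assumes "k_bounded_partition k mu" "length mu \<le> L"
  shows "\<forall>r\<ge>L. part (core_of k mu) r = 0"
proof (intro allI impI)
  fix r assume "L \<le> r"
  have "\<forall>r\<ge>length mu. part mu r = 0" by (simp add: part_zero)
  then show "part (core_of k mu) r = 0"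
    using bounded_core_zero[OF core_of_bounded_core(2)[OF assms(1)]] assms(2) \<open>L \<le> r\<close> by simp
qed

text \<open>Expresses the minimality of \<open>k\<close>-tableaux: changing entries of one, while
  staying semistandard, cannot lower the total weight.\<close>

lemma sum_k_weight_ge:
  fixes T :: "nat \<times> nat \<Rightarrow> 'n::{finite,linorder}"
  assumes "k_bounded_partition k mu" "k \<ge> 1" "semistandard (part (core_of k mu)) T"
  shows "sum_list mu \<le> (\<Sum>x\<in>UNIV. k_weight k (core_of k mu) T $ x)"
  using core_size_le_letter_residues[OF core_of_bounded_core(2)[OF assms(1)] assms(2,3)
      core_row_zero[OF assms(1) order_refl]]
  by (simp add: sum_k_weight core_of_bounded_core(1)[OF assms(1)] sum_part)

text \<open>By column strictness, restricting \<open>T\<close> to the core whose rows are the rows \<open>card U\<close>, \<open>card U + 1\<close>,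
  \<open>\<dots>\<close> of the original one avoids \<open>U\<close>, so the letters outside \<open>U\<close> carry at least its size.\<close>

lemma k_weight_upper_set:
  fixes T :: "nat \<times> nat \<Rightarrow> 'n::{finite,linorder}"
  assumes mu: "k_bounded_partition k mu" and k: "k \<ge> 1" and T: "T \<in> k_tableaux k mu"
    and U: "\<And>x y. x \<in> U \<Longrightarrow> x < y \<Longrightarrow> y \<in> U"
  shows "(\<Sum>x\<in>U. k_weight k (core_of k mu) T $ x) \<le> (\<Sum>j<card U. part mu j)"
proof -
  define i where "i = card U"
  define g where "g = part (core_of k mu)"
  define h where "h r = g (r + i)" for r
  define L where "L = length mu"
  let ?w = "\<lambda>x. k_weight k (core_of k mu) T $ x"
  have ss: "semistandard g T" and total: "(\<Sum>x\<in>UNIV. ?w x) = sum_list mu"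
    using T by (auto simp: k_tableaux_def ssyt_iff g_def)
  have core: "bounded_core k g (part mu)" unfolding g_def by (rule core_of_bounded_core(2)[OF mu])
  have coreh: "bounded_core k h (\<lambda>r. part mu (r + i))"
    unfolding h_def by (rule bounded_core_shift[OF core])
  have zero: "\<forall>r\<ge>L. g r = 0" unfolding g_def L_def by (rule core_row_zero[OF mu order_refl])
  have sub: "cells h \<subseteq> cells g"
    using antimonoD[OF bounded_coreD(1)[OF core] le_add1] unfolding cells_def h_def
    by (auto intro: less_le_trans)
  \<comment> \<open>Above a cell of \<open>h\<close>, its column in \<open>g\<close> has
    \<open>i\<close> further cells. A letter of \<open>U\<close> in it would put
    \<open>i + 1\<close> distinct letters into the upward closed \<open>U\<close>, which has only
    \<open>i\<close>.\<close>
  have avoid: "T (r, j) \<notin> U" if "(r, j) \<in> cells h" for r j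
  proof
    assume TU: "T (r, j) \<in> U"
    have less: "T (r + s, j) < T (r + t, j)" if "s < t" "t \<le> i" for s t
    proof -
      have "g (r + i) \<le> g (r + t)"
        using antimonoD[OF bounded_coreD(1)[OF core], of "r + t" "r + i"] that by simp
      then have "(r + t, j) \<in> cells g"
        using \<open>(r, j) \<in> cells h\<close> by (simp add: cells_def h_def)
      then show ?thesis using ss that unfolding semistandard_def by simp
    qed
    have "T (r + t, j) \<in> U" if "t \<le> i" for t
      using less[of 0 t] U[OF TU] TU that by (cases "t = 0") auto
    then have "(\<lambda>t. T (r + t, j)) ` {..i} \<subseteq> U" by blast
    moreover have "inj_on (\<lambda>t. T (r + t, j)) {..i}"
      by (intro linorder_inj_onI) (use less in \<open>fastforce\<close>)+
    ultimately have "card {..i} \<le> card U" by (intro card_inj_on_le) auto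
    then show False by (simp add: i_def)
  qed
  have "(\<Sum>r<L. part mu (r + i)) \<le> card (letter_residues k h T)"
    using core_size_le_letter_residues[OF coreh k semistandard_subset[OF ss sub]] zero
    by (simp add: h_def)
  also have "\<dots> \<le> card (letter_residues k g T \<inter> (- U) \<times> UNIV)"
  proof (rule card_mono)
    show "finite (letter_residues k g T \<inter> (- U) \<times> UNIV)"
      using finite_cells[OF bounded_coreD(1)[OF core] zero] by (simp add: letter_residues_def)
    show "letter_residues k h T \<subseteq> letter_residues k g T \<inter> (- U) \<times> UNIV"
      using sub avoid unfolding letter_residues_def by auto
  qed
  also have "\<dots> = (\<Sum>x\<in>-U. ?w x)"
    unfolding g_def by (simp add: sum_k_weight core_of_bounded_core(1)[OF mu])
  finally have "(\<Sum>r<L. part mu (r + i)) \<le> (\<Sum>x\<in>-U. ?w x)" .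
  moreover have "(\<Sum>x\<in>-U. ?w x) + (\<Sum>x\<in>U. ?w x) = sum_list mu"
    unfolding total[symmetric] by (subst sum.union_disjoint[symmetric]) (auto simp: Compl_partition2)
  moreover have "(\<Sum>j<i. part mu j) + (\<Sum>r<L. part mu (r + i)) = sum_list mu"
    using sum_part[of mu "i + L"] sum_lessThan_add[of "part mu" i L] by (simp add: L_def)
  ultimately show ?thesis unfolding i_def by linarith
qed

section \<open>The tableau whose weight lists the parts from the largest letter down\<close>

definition letters_above :: "'n::{finite,linorder} \<Rightarrow> nat" where
  "letters_above x = card {y. x < y}"

lemma letters_above_less_iff:
  fixes x y :: "'n::{finite,linorder}"
  shows "letters_above y < letters_above x \<longleftrightarrow> x < y"
proof -
  have *: "letters_above y < letters_above x" if "x < y" for x y :: 'n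
    unfolding letters_above_def using that by (intro psubset_card_mono) auto
  show ?thesis using *[of x y] *[of y x] by (cases x y rule: linorder_cases) auto
qed

lemma bij_letters_above: "bij_betw letters_above (UNIV :: 'n::{finite,linorder} set) {..<CARD('n)}"
proof -
  have inj: "inj (letters_above :: 'n \<Rightarrow> nat)"
    by (intro injI) (metis letters_above_less_iff linorder_neqE order_less_irrefl)
  have "letters_above x < CARD('n)" for x :: 'n
    unfolding letters_above_def by (intro psubset_card_mono) auto
  then have "range (letters_above :: 'n \<Rightarrow> nat) \<subseteq> {..<CARD('n)}" by blast
  then have "range (letters_above :: 'n \<Rightarrow> nat) = {..<CARD('n)}"
    using card_image[OF inj] by (intro card_subset_eq) auto
  then show ?thesis using inj by (simp add: bij_betw_def)
qed

lemma sum_letters_above: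
  "(\<Sum>x\<in>(UNIV :: 'n::{finite,linorder} set). f (letters_above x)) = (\<Sum>j<CARD('n). f j)"
  by (rule sum.reindex_bij_betw[OF bij_letters_above])

lemma card_letters_above_less:
  assumes "i \<le> CARD('n::{finite,linorder})"
  shows "card {x :: 'n. letters_above x < i} = i"
    "(\<Sum>x | letters_above (x :: 'n) < i. f (letters_above x)) = (\<Sum>j<i. f j)"
proof -
  have "bij_betw letters_above {x :: 'n. letters_above x < i} {..<i}"
    using bij_letters_above assms unfolding bij_betw_def
    by (auto simp: inj_on_def image_iff set_eq_iff) (metis lessThan_iff order_less_le_trans rangeE)
  then show "card {x :: 'n. letters_above x < i} = i"
    "(\<Sum>x | letters_above (x :: 'n) < i. f (letters_above x)) = (\<Sum>j<i. f j)"
    using bij_betw_same_card[of letters_above] sum.reindex_bij_betw[of letters_above] by fastforce+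
qed

text \<open>The \<open>k + 1\<close> places ending at the bead of row \<open>t\<close> hold \<open>k + 1 - u t\<close> beads, and a gap to the left
  of that bead cannot share its residue with any of them.\<close>

lemma card_gap_residues_le:
  assumes core: "bounded_core k g u"
    and P: "P \<subseteq> {p. p < bead g t} - range (bead g)"
  shows "card ((\<lambda>p. (p + d) mod int (k + 1)) ` P) \<le> u t"
proof -
  let ?m = "int (k + 1)" and ?b = "bead g"
  define s where "s = t + 1 + k - u t"
  note mono = bounded_coreD(1)[OF core]
  have bs: "?b s = ?b t - ?m" unfolding s_def by (rule bounded_core_bead[OF core])
  have range: "?b t - ?m < ?b q" "?b q \<le> ?b t" if "q \<in> {t..<s}" for q
    using that bs bead_less_iff[OF mono, of s q] bead_less_iff[OF mono, of t q] by auto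
  have cong: "p = q" if "(p + d) mod ?m = (q + d) mod ?m" "\<bar>p - q\<bar> < ?m" for p q
  proof -
    have "?m dvd p - q" using that(1) by (metis mod_eq_dvd_iff add_diff_cancel_right)
    then have "\<bar>p - q\<bar> = 0" using that(2)
      by (metis abs_ge_zero dvd_abs_iff not_less order_antisym_conv zdvd_imp_le)
    then show ?thesis by simp
  qed
  define Y where "Y = (\<lambda>q. (?b q + d) mod ?m) ` {t..<s}"
  have "inj_on (\<lambda>q. (?b q + d) mod ?m) {t..<s}"
  proof (rule inj_onI)
    fix q q' assume q: "q \<in> {t..<s}" "q' \<in> {t..<s}" "(?b q + d) mod ?m = (?b q' + d) mod ?m"
    have "\<bar>?b q - ?b q'\<bar> < ?m" using range[OF q(1)] range[OF q(2)] by linarith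
    then have "?b q = ?b q'" using cong[OF q(3)] by blast
    then show "q = q'" using bead_eq_iff[OF mono] by blast
  qed
  then have cardY: "card Y = s - t" unfolding Y_def by (simp add: card_image)
  \<comment> \<open>Beads are flush, so a gap sharing its residue with a bead of the window lies
    above that bead, hence inside the window, where residues are distinct.\<close>
  have disj: "(\<lambda>p. (p + d) mod ?m) ` P \<inter> Y = {}"
  proof (rule ccontr)
    assume "(\<lambda>p. (p + d) mod ?m) ` P \<inter> Y \<noteq> {}"
    then obtain z where "z \<in> (\<lambda>p. (p + d) mod ?m) ` P" "z \<in> Y" by blast
    then obtain p q where p: "p \<in> P" and q: "q \<in> {t..<s}"
      and eq: "(p + d) mod ?m = (?b q + d) mod ?m" unfolding Y_def by blast
    have pm: "p mod ?m = ?b q mod ?m" using eq by (metis mod_eq_dvd_iff add_diff_cancel_right)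
    have "p < ?b t" "p \<notin> range ?b" using p P by auto
    then have "\<not> p \<le> ?b q" using bead_closed'[OF core _ _ pm] by blast
    then have "\<bar>p - ?b q\<bar> < ?m" using range[OF q] \<open>p < ?b t\<close> by linarith
    then have "p = ?b q" using cong[OF eq] by blast
    then show False using \<open>p \<notin> range ?b\<close> by blast
  qed
  have fin: "finite ((\<lambda>p. (p + d) mod ?m) ` P)"
    by (rule finite_subset[of _ "{0..<?m}"]) auto
  have "card ((\<lambda>p. (p + d) mod ?m) ` P) + card Y = card ((\<lambda>p. (p + d) mod ?m) ` P \<union> Y)"
    using disj fin by (simp add: card_Un_disjoint Y_def)
  also have "\<dots> \<le> card {0..<?m}" by (intro card_mono) (auto simp: Y_def)
  finally show ?thesis using cardY bounded_coreD(2)[OF core, of t] by (simp add: s_def)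
qed

text \<open>The tableau puts the largest letter on top of each column, the next one below it, and so on.
  The cells of one letter have the residues of the gaps to the left of one bead, up to a shift; this
  bounds each weight from above, and the lower bound for the total weight makes all of these sharp.\<close>

lemma exists_k_tableau:
  fixes mu :: "nat list"
  assumes mu: "k_bounded_partition k mu" and k: "k \<ge> 1" and len: "length mu \<le> CARD('n)"
  shows "\<exists>T \<in> k_tableaux k mu. k_weight k (core_of k mu) T =
    (\<chi> x :: 'n::{finite,linorder}. part mu (letters_above x))"
proof -
  define g where "g = part (core_of k mu)"
  have core: "bounded_core k g (part mu)" unfolding g_def by (rule core_of_bounded_core(2)[OF mu])
  note mono = bounded_coreD(1)[OF core]
  have zero: "\<forall>r\<ge>CARD('n). g r = 0" unfolding g_def by (rule core_row_zero[OF mu len])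
  note h = less_height_iff[OF mono zero]
  have hle: "height g j \<le> CARD('n)" for j
    using h[of "CARD('n)" j] zero by simp
  have hmono: "height g j' \<le> height g j" if "j \<le> j'" for j j'
    using h[of "height g j" j] h[of "height g j" j'] that by (meson not_le order_less_irrefl order_le_less_trans)
  define T :: "nat \<times> nat \<Rightarrow> 'n" where "T = (\<lambda>(r, j). if (r, j) \<in> cells g
    then inv letters_above (height g j - 1 - r) else undefined)"
  have T: "letters_above (T (r, j)) = height g j - 1 - r" "r < height g j" if "(r, j) \<in> cells g" for r j
  proof -
    show "r < height g j" using that h by (simp add: cells_def)
    then have "height g j - 1 - r \<in> {..<CARD('n)}" using hle[of j] by simp
    then have "height g j - 1 - r \<in> range (letters_above :: 'n \<Rightarrow> nat)"
      using bij_letters_above[where 'n = 'n] unfolding bij_betw_def by simp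
    then show "letters_above (T (r, j)) = height g j - 1 - r"
      using that by (simp add: T_def f_inv_into_f)
  qed
  have row: "(i, j) \<in> cells g" if "(i, j') \<in> cells g" "j < j'" for i j j'
    using that by (simp add: cells_def)
  have col: "(i, j) \<in> cells g" if "(i', j) \<in> cells g" "i < i'" for i i' j
    using that antimonoD[OF mono, of i i'] by (simp add: cells_def)
  have ss: "semistandard g T" unfolding semistandard_def
  proof (intro conjI allI impI; elim conjE)
    fix i j j' assume "j < j'" "(i, j') \<in> cells g"
    then have "letters_above (T (i, j')) \<le> letters_above (T (i, j))"
      using T[of i j'] T[of i j] row[of i j' j] hmono[of j j'] by simp
    then show "T (i, j) \<le> T (i, j')" by (meson letters_above_less_iff not_le)
  next
    fix i i' j assume "i < i'" "(i', j) \<in> cells g"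
    then have "letters_above (T (i', j)) < letters_above (T (i, j))"
      using T[of i' j] T[of i j] col[of i' j i] by simp
    then show "T (i, j) < T (i', j)" by (simp add: letters_above_less_iff)
  qed
  let ?w = "\<lambda>x. k_weight k (core_of k mu) T $ x"
  have le: "?w x \<le> part mu (letters_above x)" for x
  proof -
    define t where "t = letters_above x"
    \<comment> \<open>The gaps of the columns containing the letter of rank \<open>t\<close>. In
      column \<open>j\<close> it sits in row \<open>height g j - 1 - t\<close>, whence the shift by
      \<open>t\<close> in the residues.\<close>
    define P where "P = {int j - int (height g j) + 1 | j. j < g t}"
    have "p < bead g t \<and> p \<notin> range (bead g)" if "p \<in> P" for p
    proof -
      obtain j where j: "p = int j - int (height g j) + 1" "j < g t" using \<open>p \<in> P\<close> unfolding P_def by blast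
      have "p \<noteq> bead g q" for q
        using h[of q j] j(1) by (cases "q < height g j") (auto simp: bead_def)
      then show ?thesis using j h[of t j] by (auto simp: bead_def)
    qed
    then have "card ((\<lambda>p. (p + int t) mod int (k + 1)) ` P) \<le> part mu t"
      by (intro card_gap_residues_le[OF core]) auto
    moreover have "residue (k + 1) ` {c \<in> cells g. T c = x} \<subseteq> (\<lambda>p. (p + int t) mod int (k + 1)) ` P"
    proof clarify
      fix r j assume c: "(r, j) \<in> cells g" "x = T (r, j)"
      then have t: "t = height g j - 1 - r" "r < height g j" using T by (auto simp: t_def)
      then have "j < g t" using h[of t j] by simp
      then have "int j - int (height g j) + 1 \<in> P" unfolding P_def by blast
      moreover have "residue (k + 1) (r, j) = (int j - int (height g j) + 1 + int t) mod int (k + 1)"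
        using t by (simp add: of_nat_diff algebra_simps)
      ultimately show "residue (k + 1) (r, j) \<in> (\<lambda>p. (p + int t) mod int (k + 1)) ` P" by blast
    qed
    moreover have "finite ((\<lambda>p. (p + int t) mod int (k + 1)) ` P)"
      by (rule finite_subset[of _ "{0..<int (k + 1)}"]) auto
    ultimately have "card (residue (k + 1) ` {c \<in> cells g. T c = x}) \<le> part mu t"
      using card_mono order_trans by blast
    then show ?thesis by (simp add: k_weight_def diagram_eq_cells g_def t_def)
  qed
  have sum_mu: "(\<Sum>x\<in>UNIV. part mu (letters_above (x :: 'n))) = sum_list mu"
    using sum_letters_above[where 'n = 'n, of "part mu"] sum_part[OF len] by simp
  then have eq: "(\<Sum>x\<in>UNIV. ?w x) = (\<Sum>x\<in>UNIV. part mu (letters_above (x :: 'n)))"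
    using sum_k_weight_ge[OF mu k, of T] ss sum_mono[of UNIV ?w, OF le] g_def by simp
  then have "?w x = part mu (letters_above x)" for x
    using sum_mono_inv[OF eq le] by simp
  moreover have "T \<in> k_tableaux k mu"
    using ss eq sum_mu unfolding k_tableaux_def ssyt_iff diagram_eq_cells g_def[symmetric]
    by (auto simp: T_def extensional_def)
  ultimately show ?thesis by (intro bexI[of _ T]) (simp_all add: vec_eq_iff)
qed

text \<open>Replacing the last \<open>x\<close> of the bottom row by \<open>y\<close> lowers the weight of \<open>x\<close> by one and raises
  that of \<open>y\<close> by at most one. The total weight cannot drop below the size of \<open>mu\<close>, so the weight
  of \<open>y\<close> does increase.\<close>

lemma k_tableau_transfer:
  fixes T :: "nat \<times> nat \<Rightarrow> 'n::{finite,linorder}"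
  assumes mu: "k_bounded_partition k mu" and k: "k \<ge> 1" and T: "T \<in> k_tableaux k mu"
    and x: "\<And>z. x \<le> z" and y: "x < y" "\<And>z. x < z \<Longrightarrow> y \<le> z"
    and le_k: "k_weight k (core_of k mu) T $ x \<le> k"
    and gap: "k_weight k (core_of k mu) T $ y + 2 \<le> k_weight k (core_of k mu) T $ x"
  shows "\<exists>T' \<in> k_tableaux k mu. k_weight k (core_of k mu) T' =
    k_weight k (core_of k mu) T - axis x 1 + axis y 1"
proof -
  define g where "g = part (core_of k mu)"
  let ?w = "k_weight k (core_of k mu)"
  let ?m = "int (k + 1)"
  have part: "is_partition (core_of k mu)" by (rule core_of_bounded_core(1)[OF mu])
  have mono: "antimono g" unfolding g_def by (rule is_partition_antimono[OF part])
  have ss: "semistandard g T" and ext: "T \<in> extensional (cells g)"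
    and total: "(\<Sum>x\<in>UNIV. ?w T $ x) = sum_list mu"
    using T by (auto simp: k_tableaux_def ssyt_iff g_def diagram_eq_cells)
  have fin: "finite (cells g)" unfolding g_def using finite_diagram[OF part] by (simp add: diagram_eq_cells)
  have w: "?w T' $ z = card (residue (k + 1) ` {c \<in> cells g. T' c = z})" for T' z
    by (simp add: k_weight_def diagram_eq_cells g_def)
  have row: "T (i, j) \<le> T (i, j')" if "j < j'" "(i, j') \<in> cells g" for i j j'
    using ss that unfolding semistandard_def by blast
  have col: "T (i, j) < T (i', j)" if "i < i'" "(i', j) \<in> cells g" for i i' j
    using ss that unfolding semistandard_def by blast
  define J where "J = {j. j < g 0 \<and> T (0, j) = x}"
  define s where "s = card J"
  have "finite J" unfolding J_def by simp
  have down: "j \<in> J" if "j < j'" "j' \<in> J" for j j'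
    using that row[of j j' 0] x[of "T (0, j)"] unfolding J_def cells_def by auto
  have J: "J = {..<s}"
  proof -
    have "\<exists>n. J = {..<n}"
    proof (cases "J = {}")
      case False
      have "J = {..<Suc (Max J)}"
      proof
        show "J \<subseteq> {..<Suc (Max J)}" using \<open>finite J\<close> by (auto simp: less_Suc_eq_le)
        show "{..<Suc (Max J)} \<subseteq> J"
          using down[of _ "Max J"] Max_in[OF \<open>finite J\<close> False] by (auto simp: less_Suc_eq)
      qed
      then show ?thesis by blast
    qed auto
    then show ?thesis unfolding s_def by auto
  qed
  \<comment> \<open>The smallest letter cannot lie above another cell, so it fills an initial
    segment of the bottom row.\<close>
  have xcells: "{c \<in> cells g. T c = x} = {0} \<times> {..<s}"
  proof -
    have "i = 0" if "(i, j) \<in> cells g" "T (i, j) = x" for i j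
      using col[of 0 i j] x[of "T (0, j)"] that by (cases i) auto
    then show ?thesis unfolding J[symmetric] J_def cells_def by auto
  qed
  have res0: "residue (k + 1) ` ({0} \<times> {..<n}) = (\<lambda>j. int j mod ?m) ` {..<n}" for n
    by (force simp: image_iff)
  have inj: "inj_on (\<lambda>j. (int j + d) mod ?m) {..<n}" if "n \<le> k + 1" for n d
  proof (rule inj_onI)
    fix i j assume ij: "i \<in> {..<n}" "j \<in> {..<n}" "(int i + d) mod ?m = (int j + d) mod ?m"
    then have "?m dvd int i - int j" by (metis mod_eq_dvd_iff add_diff_cancel_right)
    moreover have "\<bar>int i - int j\<bar> < ?m" using ij that by auto
    ultimately have "\<bar>int i - int j\<bar> = 0"
      by (metis abs_ge_zero dvd_abs_iff not_less order_antisym_conv zdvd_imp_le)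
    then show "i = j" by simp
  qed
  have inj0: "inj_on (\<lambda>j. int j mod ?m) {..<n}" if "n \<le> k + 1" for n
    using inj[OF that, of 0] by simp
  \<comment> \<open>With more than \<open>k\<close> cells, \<open>x\<close> would have all
    \<open>k + 1\<close> residues. Hence its cells have distinct residues and \<open>s\<close> is
    its weight.\<close>
  have "s \<le> k"
  proof (rule ccontr)
    assume "\<not> s \<le> k"
    then have "(\<lambda>j. int j mod ?m) ` {..<k + 1} \<subseteq> (\<lambda>j. int j mod ?m) ` {..<s}"
      by (intro image_mono) auto
    then have "card ((\<lambda>j. int j mod ?m) ` {..<k + 1}) \<le> ?w T $ x"
      unfolding w xcells res0 by (intro card_mono) auto
    then show False using card_image[OF inj0[of "k + 1"]] le_k by simp
  qed
  then have wx: "?w T $ x = s" unfolding w xcells res0 using card_image[OF inj0[of s]] by simp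
  then have "s \<ge> 2" using gap by simp
  have J_iff: "j < g 0 \<and> T (0, j) = x \<longleftrightarrow> j < s" for j using J unfolding J_def by blast
  have s1: "(0, s - 1) \<in> cells g" "T (0, s - 1) = x"
    using J_iff[of "s - 1"] \<open>s \<ge> 2\<close> by (auto simp: cells_def)
  define T' where "T' = T((0, s - 1) := y)"
  \<comment> \<open>A \<open>y\<close> above this cell forces a \<open>y\<close> above every
    \<open>x\<close> of the bottom row. Then \<open>y\<close> has at least \<open>s\<close>
    residues, against the assumed gap.\<close>
  have no_y: "y < T (i, s - 1)" if c: "(i, s - 1) \<in> cells g" "0 < i" for i
  proof (rule ccontr)
    assume "\<not> y < T (i, s - 1)"
    have c1: "(1, j) \<in> cells g" if "j < s" for j
      using c that antimonoD[OF mono, of 1 i] by (auto simp: cells_def)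
    have "y \<le> T (1, s - 1)" using y(2) col[of 0 1 "s - 1"] c1[of "s - 1"] s1(2) \<open>s \<ge> 2\<close> by simp
    moreover have "T (1, s - 1) \<le> T (i, s - 1)" using col[of 1 i "s - 1"] c by (cases "i = 1") auto
    ultimately have ty: "T (1, s - 1) = y" using \<open>\<not> y < T (i, s - 1)\<close> by simp
    have "T (1, j) = y" if "j < s" for j
    proof (rule antisym)
      show "T (1, j) \<le> y"
        using row[of j "s - 1" 1] c1[of "s - 1"] ty that by (cases "j = s - 1") auto
      have "T (0, j) = x" using J_iff[of j] that by simp
      then show "y \<le> T (1, j)" using y(2) col[of 0 1 j] c1[OF that] by simp
    qed
    then have "{1} \<times> {..<s} \<subseteq> {c \<in> cells g. T c = y}" using c1 by auto
    then have "residue (k + 1) ` ({1} \<times> {..<s}) \<subseteq> residue (k + 1) ` {c \<in> cells g. T c = y}" by blast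
    moreover have "residue (k + 1) ` ({1} \<times> {..<s}) = (\<lambda>j. (int j + - 1) mod ?m) ` {..<s}"
      by (force simp: image_iff)
    ultimately have "card ((\<lambda>j. (int j + - 1) mod ?m) ` {..<s}) \<le> ?w T $ y"
      unfolding w using fin by (metis (no_types, lifting) card_mono finite_imageI finite_Collect_conjI mem_Collect_eq finite_subset subsetI)
    then show False using card_image[OF inj[of s "- 1"]] \<open>s \<le> k\<close> gap wx by simp
  qed
  have ss': "semistandard g T'" unfolding semistandard_def
  proof (intro conjI allI impI; elim conjE)
    fix i j j' assume a: "j < j'" "(i, j') \<in> cells g"
    show "T' (i, j) \<le> T' (i, j')"
    proof (cases "(i, j) = (0, s - 1)")
      case True
      then have "T (0, j') \<noteq> x" using a J_iff[of j'] by (auto simp: cells_def)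
      then have "x < T (0, j')" using x[of "T (0, j')"] by simp
      then show ?thesis using True a y(2) by (simp add: T'_def)
    next
      case False
      then have T'j: "T' (i, j) = T (i, j)" by (auto simp: T'_def)
      have "T (i, j') \<le> T' (i, j')" using s1(2) y(1) by (auto simp: T'_def)
      then show ?thesis using row[OF a] T'j by simp
    qed
  next
    fix i i' j assume a: "i < i'" "(i', j) \<in> cells g"
    show "T' (i, j) < T' (i', j)"
      using col[OF a] no_y[of i'] a by (auto simp: T'_def)
  qed
  have "{c \<in> cells g. T' c = x} = {0} \<times> {..<s - 1}"
  proof -
    have "{c \<in> cells g. T' c = x} = {c \<in> cells g. T c = x} - {(0, s - 1)}"
      using y(1) by (auto simp: T'_def)
    moreover have "{0} \<times> {..<s} - {(0, s - 1)} = {0} \<times> {..<s - 1}" by (auto simp: less_diff_conv)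
    ultimately show ?thesis unfolding xcells by simp
  qed
  then have wx': "?w T' $ x = s - 1"
    using card_image[OF inj0[of "s - 1"]] \<open>s \<le> k\<close> res0[of "s - 1"] w[of T' x] by simp
  have wy': "?w T' $ y \<le> ?w T $ y + 1"
  proof -
    have "{c \<in> cells g. T' c = y} = insert (0, s - 1) {c \<in> cells g. T c = y}"
      using s1(1) by (auto simp: T'_def)
    then show ?thesis unfolding w using fin by (simp add: card_insert_if del: residue.simps)
  qed
  have wz': "?w T' $ z = ?w T $ z" if "z \<noteq> x" "z \<noteq> y" for z
  proof -
    have "{c \<in> cells g. T' c = z} = {c \<in> cells g. T c = z}" using that s1(2) by (auto simp: T'_def)
    then show ?thesis unfolding w by simp
  qed
  have split: "(\<Sum>z\<in>UNIV. f z) = f x + f y + (\<Sum>z\<in>UNIV - {x, y}. f z)" for f :: "'n \<Rightarrow> nat"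
    using y(1) by (subst sum.subset_diff[of "{x, y}"]) auto
  have rest: "(\<Sum>z\<in>UNIV - {x, y}. ?w T' $ z) = (\<Sum>z\<in>UNIV - {x, y}. ?w T $ z)"
    by (intro sum.cong) (auto simp: wz')
  have "sum_list mu \<le> (\<Sum>z\<in>UNIV. ?w T' $ z)"
    using sum_k_weight_ge[OF mu k] ss' by (simp add: g_def)
  then have wy: "?w T' $ y = ?w T $ y + 1"
    using total wx wx' wy' rest \<open>s \<ge> 2\<close> unfolding split by simp
  have "?w T' = ?w T - axis x 1 + axis y 1"
    using wx wx' wy wz' y(1) by (auto simp: vec_eq_iff axis_def)
  moreover have "T' \<in> k_tableaux k mu"
    unfolding k_tableaux_def ssyt_iff diagram_eq_cells g_def[symmetric]
    using ss' ext s1(1) total wx wx' wy rest \<open>s \<ge> 2\<close>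
    by (auto simp: T'_def extensional_def split)
  ultimately show ?thesis by blast
qed

section \<open>Lattice points of the permutohedron\<close>

lemma sum_antimono_le:
  fixes f :: "nat \<Rightarrow> nat"
  assumes "antimono f" "finite A"
  shows "(\<Sum>j\<in>A. f j) \<le> (\<Sum>j<card A. f j)"
  using assms(2)
proof (induction A rule: finite_linorder_max_induct)
  case (insert b A)
  then have "A \<subseteq> {..<b}" by blast
  then have "card A \<le> b" using card_mono[of "{..<b}" A] by simp
  then have "f b \<le> f (card A)" by (rule antimonoD[OF assms(1)])
  moreover have "b \<notin> A" using insert.hyps by blast
  ultimately show ?case using insert by simp
qed simp

text \<open>Passing from \<open>A\<close> to the union adds as many terms as passing from the
  intersection to \<open>B\<close>, but at later indices, where they are no larger.\<close>

lemma sum_antimono_submodular: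
  fixes f :: "nat \<Rightarrow> nat"
  assumes "antimono f" "finite A" "finite B"
  shows "(\<Sum>j<card (A \<union> B). f j) + (\<Sum>j<card (A \<inter> B). f j) \<le> (\<Sum>j<card A. f j) + (\<Sum>j<card B. f j)"
proof -
  define n where "n = card (B - A)"
  have "card (A \<union> B) = card A + n"
    using assms card_Un_disjoint[of A "B - A"] by (simp add: n_def)
  moreover have "card B = card (A \<inter> B) + n"
    using card_Int_Diff[OF assms(3), of A] by (simp add: n_def inf_commute)
  moreover have "(\<Sum>j<n. f (j + card A)) \<le> (\<Sum>j<n. f (j + card (A \<inter> B)))"
    using assms by (intro sum_mono antimonoD[OF assms(1)] add_left_mono card_mono) auto
  ultimately show ?thesis by (simp add: sum_lessThan_add)
qed

text \<open>For a partition with at most \<open>CARD('n)\<close> parts these are the lattice points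
  of the permutohedron, cut out by Rado's inequalities. Letting \<open>U\<close> range over all sets
  avoids sorting the entries of \<open>a\<close>.\<close>

definition dominated_vectors :: "nat list \<Rightarrow> (nat ^ 'n::finite) set" where
  "dominated_vectors la = {a. (\<Sum>x\<in>UNIV. a $ x) = sum_list la \<and>
     (\<forall>U. (\<Sum>x\<in>U. a $ x) \<le> (\<Sum>j<card U. part la j))}"

text \<open>Stated additively because subtraction of naturals truncates.\<close>

lemma sum_transfer:
  fixes a :: "nat ^ 'n::finite"
  assumes "0 < a $ i"
  shows "(\<Sum>x\<in>U. (a - axis i 1 + axis j 1) $ x) + of_bool (i \<in> U) = (\<Sum>x\<in>U. a $ x) + of_bool (j \<in> U)"
proof -
  have "(\<Sum>x\<in>U. (a - axis i 1 + axis j 1) $ x + (if x = i then 1 else 0)) =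
      (\<Sum>x\<in>U. a $ x + (if x = j then 1 else 0))"
    using assms by (intro sum.cong) (auto simp: axis_def)
  then show ?thesis by (simp add: sum.distrib sum.delta of_bool_def)
qed

text \<open>Sets whose inequality is an equality for \<open>a\<close> are closed under unions, by submodularity.
  If no exchange partner \<open>j\<close> works, each violates a set tight for \<open>a\<close> that avoids \<open>i\<close>; the union
  of these sets contradicts the inequality for \<open>b\<close>.\<close>

lemma dominated_vectors_exchange:
  fixes a b :: "nat ^ 'n::finite"
  assumes la: "is_partition la" and a: "a \<in> dominated_vectors la" and b: "b \<in> dominated_vectors la"
    and i: "b $ i < a $ i"
  shows "\<exists>j. a $ j < b $ j \<and> a - axis i 1 + axis j 1 \<in> dominated_vectors la"
proof (rule ccontr)
  assume no: "\<not> ?thesis"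
  define G where "G n = (\<Sum>j<n. part la j)" for n
  define tight where "tight U \<longleftrightarrow> (\<Sum>x\<in>U. a $ x) = G (card U)" for U
  have aG: "(\<Sum>x\<in>U. a $ x) \<le> G (card U)" and bG: "(\<Sum>x\<in>U. b $ x) \<le> G (card U)" for U
    using a b by (auto simp: dominated_vectors_def G_def)
  have tight_Un: "tight (U \<union> V)" if "tight U" "tight V" for U V
  proof -
    have "(\<Sum>x\<in>U \<union> V. a $ x) + (\<Sum>x\<in>U \<inter> V. a $ x) = G (card U) + G (card V)"
      using that sum.union_inter[of U V "($) a"] by (simp add: tight_def)
    moreover have "G (card (U \<union> V)) + G (card (U \<inter> V)) \<le> G (card U) + G (card V)"
      unfolding G_def by (rule sum_antimono_submodular[OF is_partition_antimono[OF la]]) auto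
    ultimately show ?thesis using aG[of "U \<union> V"] aG[of "U \<inter> V"] by (simp add: tight_def)
  qed
  define D where "D = {j. a $ j < b $ j}"
  have "\<exists>U. tight U \<and> j \<in> U \<and> i \<notin> U" if "j \<in> D" for j
  proof -
    let ?a = "a - axis i 1 + axis j 1"
    have "0 < a $ i" using i by simp
    note st = sum_transfer[OF this, where j = j]
    have "?a \<notin> dominated_vectors la" using no that by (auto simp: D_def)
    \<comment> \<open>The transfer keeps the total, so some set inequality fails. It held for
      \<open>a\<close>, so \<open>U\<close> gained a unit and was tight.\<close>
    then obtain U where U: "\<not> (\<Sum>x\<in>U. ?a $ x) \<le> G (card U)"
      using st[of UNIV] a by (auto simp: dominated_vectors_def G_def)
    then have "j \<in> U \<and> i \<notin> U \<and> tight U"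
      using st[of U] aG[of U] by (auto simp: tight_def of_bool_def split: if_splits)
    then show ?thesis by blast
  qed
  then obtain S where S: "\<And>j. j \<in> D \<Longrightarrow> tight (S j) \<and> j \<in> S j \<and> i \<notin> S j" by metis
  define W where "W = (\<Union>j\<in>D. S j)"
  have "tight (\<Union>j\<in>E. S j)" if "E \<subseteq> D" for E
    using finite[of E] that
    by (induction E rule: finite_induct) (use S tight_Un in \<open>auto simp: tight_def[of "{}"] G_def\<close>)
  then have "tight W" unfolding W_def by blast
  then have bW: "(\<Sum>x\<in>W. b $ x) \<le> (\<Sum>x\<in>W. a $ x)" using bG[of W] by (simp add: tight_def)
  have "i \<notin> W" using S by (auto simp: W_def)
  \<comment> \<open>Every index where \<open>b\<close> exceeds \<open>a\<close> lies in
    \<open>W\<close>. Outside \<open>W\<close>, \<open>a\<close> is at least \<open>b\<close> and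
    larger at \<open>i\<close>; with equal totals this contradicts \<open>bW\<close>.\<close>
  have "b $ x \<le> a $ x" if "x \<in> - W" for x using S[of x] that by (force simp: W_def D_def)
  then have "(\<Sum>x\<in>-W. b $ x) < (\<Sum>x\<in>-W. a $ x)"
    using i \<open>i \<notin> W\<close> by (intro sum_strict_mono_ex1) auto
  moreover have compl: "(\<Sum>x\<in>-W. c $ x) + (\<Sum>x\<in>W. c $ x) = (\<Sum>x\<in>UNIV. c $ x)" for c :: "nat ^ 'n"
    by (subst sum.union_disjoint[symmetric]) (auto simp: Compl_partition2)
  moreover have "(\<Sum>x\<in>UNIV. a $ x) = (\<Sum>x\<in>UNIV. b $ x)"
    using a b by (simp add: dominated_vectors_def)
  ultimately show False using bW compl[of a] compl[of b] by linarith
qed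

text \<open>Muirhead's argument: if \<open>a\<close> dominates the decreasing vector \<open>b\<close> along an enumeration \<open>e\<close>,
  let \<open>j\<close> be the first index where \<open>a\<close> is too small. Some earlier \<open>i\<close> has too large an entry, and
  moving one unit from \<open>i\<close> to \<open>j\<close> brings \<open>a\<close> closer to \<open>b\<close>.\<close>

lemma transfer_reachable:
  fixes a b :: "nat ^ 'n::finite" and e :: "nat \<Rightarrow> 'n"
  assumes e: "bij_betw e {..<n} (UNIV :: 'n set)"
    and anti: "\<And>l m. l \<le> m \<Longrightarrow> m < n \<Longrightarrow> b $ e m \<le> b $ e l"
    and closed: "\<And>a i j. P a \<Longrightarrow> a $ j + 2 \<le> a $ i \<Longrightarrow> P (a - axis i 1 + axis j 1)"
    and "P a"
    and "\<And>m. m \<le> n \<Longrightarrow> (\<Sum>l<m. b $ e l) \<le> (\<Sum>l<m. a $ e l)"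
    and "(\<Sum>l<n. b $ e l) = (\<Sum>l<n. a $ e l)"
  shows "P b"
  using assms(4-)
proof (induction "\<Sum>l<n. nat \<bar>int (a $ e l) - int (b $ e l)\<bar>" arbitrary: a rule: less_induct)
  case (less a)
  note prefix = less.prems(2) and total = less.prems(3)
  have inj: "e l = e m \<longleftrightarrow> l = m" if "l < n" "m < n" for l m
    using e that by (auto simp: bij_betw_def inj_on_def)
  have surj: "\<exists>l<n. x = e l" for x
  proof -
    have "x \<in> e ` {..<n}" using e by (simp add: bij_betw_def)
    then show ?thesis by auto
  qed
  show ?case
  proof (cases "\<forall>l<n. a $ e l = b $ e l")
    case True
    then have "a = b" using surj by (metis vec_eq_iff)
    then show ?thesis using less.prems(1) by simp
  next
    case False
    let ?Q = "\<lambda>j. j < n \<and> a $ e j < b $ e j"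
    have "\<exists>j. ?Q j"
    proof (rule ccontr)
      assume "\<not> ?thesis"
      then have "\<forall>l\<in>{..<n}. b $ e l \<le> a $ e l" by force
      moreover have "\<exists>l\<in>{..<n}. b $ e l < a $ e l"
        using False calculation by (metis lessThan_iff order_le_imp_less_or_eq)
      ultimately have "(\<Sum>l<n. b $ e l) < (\<Sum>l<n. a $ e l)" by (intro sum_strict_mono_ex1) auto
      then show False using total by simp
    qed
    then obtain j where j: "?Q j" "\<And>l. l < j \<Longrightarrow> \<not> ?Q l" using exists_least_iff[of ?Q] by blast
    have before: "b $ e l \<le> a $ e l" if "l < j" for l using j that by force
    have "\<exists>i<j. b $ e i < a $ e i"
    proof (rule ccontr)
      assume "\<not> ?thesis"
      then have "(\<Sum>l<j. a $ e l) \<le> (\<Sum>l<j. b $ e l)" by (intro sum_mono) force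
      then show False using prefix[of "Suc j"] j(1) by simp
    qed
    then obtain i where i: "i < j" "b $ e i < a $ e i" by blast
    \<comment> \<open>The chain \<open>a $ e j < b $ e j \<le> b $ e i < a $ e i\<close> yields a
      gap of at least 2.\<close>
    have "b $ e j \<le> b $ e i" using anti[of i j] i(1) j(1) by simp
    then have gap: "a $ e j + 2 \<le> a $ e i" using i(2) j(1) by linarith
    define a' where "a' = a - axis (e i) 1 + axis (e j) 1"
    have a': "a' $ e l = (if l = i then a $ e i - 1 else if l = j then a $ e j + 1 else a $ e l)" if "l < n" for l
      using that i j inj[of l i] inj[of l j] by (auto simp: a'_def axis_def)
    have sum_a': "(\<Sum>l<m. a' $ e l) + of_bool (i < m) = (\<Sum>l<m. a $ e l) + of_bool (j < m)" if "m \<le> n" for m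
    proof -
      have "(\<Sum>l<m. a' $ e l + (if l = i then 1 else 0)) = (\<Sum>l<m. a $ e l + (if l = j then 1 else 0))"
        using that i gap by (intro sum.cong) (auto simp: a')
      then show ?thesis by (simp add: sum.distrib sum.delta of_bool_def)
    qed
    have "P a'" unfolding a'_def by (rule closed[OF less.prems(1) gap])
    moreover have "(\<Sum>l<n. nat \<bar>int (a' $ e l) - int (b $ e l)\<bar>) < (\<Sum>l<n. nat \<bar>int (a $ e l) - int (b $ e l)\<bar>)"
      using i j(1) gap by (intro sum_strict_mono_ex1) (auto simp: a' intro!: bexI[of _ i])
    moreover have "(\<Sum>l<m. b $ e l) \<le> (\<Sum>l<m. a' $ e l)" if "m \<le> n" for m
    \<comment> \<open>Only prefixes containing \<open>i\<close> but not \<open>j\<close> lose a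
      unit. There the inequality was strict, since no entry before \<open>j\<close> is too small and
      the one at \<open>i\<close> is too large.\<close>
    proof (cases "i < m \<and> m \<le> j")
      case True
      then have "(\<Sum>l<m. b $ e l) < (\<Sum>l<m. a $ e l)"
        using before i by (intro sum_strict_mono_ex1) auto
      then show ?thesis using sum_a'[OF that] True by simp
    next
      case False
      then show ?thesis using sum_a'[OF that] prefix[OF that] i(1) by (auto simp: of_bool_def split: if_splits)
    qed
    moreover have "(\<Sum>l<n. b $ e l) = (\<Sum>l<n. a' $ e l)"
      using sum_a'[of n] total i(1) j(1) by simp
    ultimately show ?thesis using less.hyps by blast
  qed
qed

section \<open>Lattice points and the convex hull of the rearrangements\<close>

lemma obtain_decreasing_enumeration:
  fixes b :: "'n::finite \<Rightarrow> nat"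
  obtains e where "bij_betw e {..<CARD('n)} (UNIV :: 'n set)"
    "\<And>l m. l \<le> m \<Longrightarrow> m < CARD('n) \<Longrightarrow> b (e m) \<le> b (e l)"
proof -
  obtain ys :: "'n list" where ys: "set ys = UNIV" "distinct ys"
    using finite_distinct_list[of "UNIV :: 'n set"] by auto
  define xs where "xs = sort_key (\<lambda>x. - int (b x)) ys"
  have xs: "set xs = UNIV" "distinct xs" using ys by (simp_all add: xs_def)
  then have len: "length xs = CARD('n)" using distinct_card by fastforce
  show ?thesis
  proof
    show "bij_betw ((!) xs) {..<CARD('n)} UNIV" using bij_betw_nth[OF xs(2)] xs(1) len by simp
  next
    fix l m :: nat assume lm: "l \<le> m" "m < CARD('n)"
    have "sorted (map (\<lambda>x. - int (b x)) xs)" by (simp add: xs_def)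
    then have "map (\<lambda>x. - int (b x)) xs ! l \<le> map (\<lambda>x. - int (b x)) xs ! m"
      using lm len by (intro sorted_nth_mono) auto
    then show "b (xs ! m) \<le> b (xs ! l)" using lm len by simp
  qed
qed

text \<open>From the rearrangement of \<open>la\<close> ordered like \<open>b\<close>, Muirhead
  transfers lead to \<open>b\<close>. This proves membership both in the permutohedron and in the
  support of \<open>f\<close>.\<close>

lemma dominated_vectors_induct:
  fixes b :: "nat ^ 'n::finite"
  assumes len: "length la \<le> CARD('n)" and b: "b \<in> dominated_vectors la"
    and base: "\<And>s. bij_betw s (UNIV :: 'n set) {..<CARD('n)} \<Longrightarrow> P (\<chi> x. part la (s x))"
    and closed: "\<And>a i j. P a \<Longrightarrow> a $ j + 2 \<le> a $ i \<Longrightarrow> P (a - axis i 1 + axis j 1)"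
  shows "P b"
proof -
  obtain e where e: "bij_betw e {..<CARD('n)} (UNIV :: 'n set)"
    and anti: "\<And>l m. l \<le> m \<Longrightarrow> m < CARD('n) \<Longrightarrow> b $ e m \<le> b $ e l"
    using obtain_decreasing_enumeration[of "($) b"] by blast
  define s where "s = the_inv_into {..<CARD('n)} e"
  have s: "bij_betw s UNIV {..<CARD('n)}" unfolding s_def by (rule bij_betw_the_inv_into[OF e])
  have se: "s (e l) = l" if "l < CARD('n)" for l
    unfolding s_def using e that by (intro the_inv_into_f_f) (auto simp: bij_betw_def)
  have sum_e: "(\<Sum>l<m. b $ e l) = (\<Sum>x\<in>e ` {..<m}. b $ x)" "card (e ` {..<m}) = m" if "m \<le> CARD('n)" for m
  proof -
    have "inj_on e {..<m}" using e that by (auto simp: bij_betw_def inj_on_def)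
    then show "(\<Sum>l<m. b $ e l) = (\<Sum>x\<in>e ` {..<m}. b $ x)" "card (e ` {..<m}) = m"
      by (simp_all add: sum.reindex card_image)
  qed
  have sum_s: "(\<Sum>l<m. (\<chi> x. part la (s x)) $ e l) = (\<Sum>l<m. part la l)" if "m \<le> CARD('n)" for m
    using that by (intro sum.cong) (auto simp: se)
  show ?thesis
  proof (rule transfer_reachable[OF e anti closed base[OF s]])
    fix m assume m: "m \<le> CARD('n)"
    have "(\<Sum>x\<in>e ` {..<m}. b $ x) \<le> (\<Sum>j<card (e ` {..<m}). part la j)"
      using b unfolding dominated_vectors_def by blast
    then show "(\<Sum>l<m. b $ e l) \<le> (\<Sum>l<m. (\<chi> x. part la (s x)) $ e l)"
      using sum_e[OF m] sum_s[OF m] by simp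
  next
    have "e ` {..<CARD('n)} = UNIV" using e by (simp add: bij_betw_def)
    then show "(\<Sum>l<CARD('n). b $ e l) = (\<Sum>l<CARD('n). (\<chi> x. part la (s x)) $ e l)"
      using sum_e(1)[OF order_refl] sum_s[OF order_refl] sum_part[OF len] b
      by (simp add: dominated_vectors_def)
  qed
qed

lemma permutohedron_permute:
  fixes x :: "real ^ 'n::finite"
  assumes p: "p permutes (UNIV :: 'n set)" and x: "x \<in> permutohedron la"
  shows "(\<chi> i. x $ p i) \<in> permutohedron la"
proof -
  define V :: "(real ^ 'n) set" where "V = {(\<chi> i. real (part la (s i))) | s. bij_betw s (UNIV :: 'n set) {..<CARD('n)}}"
  define \<phi> where "\<phi> x = (\<chi> i. x $ p i)" for x :: "real ^ 'n"
  have "linear \<phi>" unfolding \<phi>_def by (rule linearI) (simp_all add: vec_eq_iff)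
  have "\<phi> ` V \<subseteq> V"
  proof
    fix y assume "y \<in> \<phi> ` V"
    then obtain s where s: "bij_betw s (UNIV :: 'n set) {..<CARD('n)}" "y = (\<chi> i. real (part la (s (p i))))"
      by (auto simp: V_def \<phi>_def)
    have "bij_betw (s \<circ> p) UNIV {..<CARD('n)}"
      by (rule bij_betw_trans[OF permutes_imp_bij[OF p] s(1)])
    then show "y \<in> V" unfolding V_def s(2) by (auto intro!: exI[of _ "s \<circ> p"])
  qed
  then have "\<phi> ` (convex hull V) \<subseteq> convex hull V"
    unfolding convex_hull_linear_image[OF \<open>linear \<phi>\<close>] by (rule hull_mono)
  then show ?thesis using x unfolding permutohedron_def V_def[symmetric] \<phi>_def by blast
qed

lemma dominated_vectors_permutohedron:
  fixes b :: "nat ^ 'n::finite"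
  assumes "length la \<le> CARD('n)" "b \<in> dominated_vectors la"
  shows "real_vec b \<in> permutohedron la"
  using assms
proof (rule dominated_vectors_induct[where P = "\<lambda>a. real_vec a \<in> permutohedron la"])
  fix s assume "bij_betw s (UNIV :: 'n set) {..<CARD('n)}"
  then show "real_vec (\<chi> x. part la (s x)) \<in> permutohedron la"
    unfolding permutohedron_def by (intro hull_inc) (auto simp: real_vec_def)
next
  fix a :: "nat ^ 'n" and i j
  assume a: "real_vec a \<in> permutohedron la" and gap: "a $ j + 2 \<le> a $ i"
  \<comment> \<open>Mixing \<open>a\<close> with its image under swapping \<open>i\<close> and
    \<open>j\<close> in this proportion moves exactly one unit.\<close>
  define t where "t = 1 / (real (a $ i) - real (a $ j))"
  have t: "0 \<le> t" "t \<le> 1" "t * (real (a $ i) - real (a $ j)) = 1" using gap by (auto simp: t_def)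
  define y where "y = (\<chi> x. real_vec a $ Transposition.transpose i j x)"
  have "y \<in> permutohedron la" unfolding y_def
    by (intro permutohedron_permute[OF _ a] permutes_swap_id) auto
  then have "(1 - t) *\<^sub>R real_vec a + t *\<^sub>R y \<in> permutohedron la"
    using a t unfolding permutohedron_def by (intro convexD[OF convex_convex_hull]) auto
  moreover have "(1 - t) *\<^sub>R real_vec a + t *\<^sub>R y = real_vec (a - axis i 1 + axis j 1)"
  proof (rule vec_eq_iff[THEN iffD2], rule allI)
    fix x
    have "i \<noteq> j" using gap by auto
    then show "((1 - t) *\<^sub>R real_vec a + t *\<^sub>R y) $ x = real_vec (a - axis i 1 + axis j 1) $ x"
      using t(3) gap
      by (cases "x = i"; cases "x = j")
        (simp_all add: y_def real_vec_def axis_def of_nat_diff algebra_simps)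
  qed
  ultimately show "real_vec (a - axis i 1 + axis j 1) \<in> permutohedron la" by simp
qed

lemma integral_permutohedron:
  fixes x :: "real ^ 'n::finite"
  assumes la: "is_partition la" and len: "length la \<le> CARD('n)"
    and x: "x \<in> permutohedron la" "\<And>i. x $ i \<in> \<int>"
  shows "x \<in> real_vec ` dominated_vectors la"
proof -
  \<comment> \<open>A convex set containing the generators. Nonnegativity is included so that its
    integral points come from vectors of naturals.\<close>
  define C where "C = {x :: real ^ 'n. (\<forall>i. 0 \<le> x $ i) \<and> (\<Sum>i\<in>UNIV. x $ i) = real (sum_list la) \<and>
    (\<forall>U. (\<Sum>i\<in>U. x $ i) \<le> real (\<Sum>j<card U. part la j))}"
  have "convex C"
  proof (rule convexI)
    fix x y :: "real ^ 'n" and u v :: real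
    assume xy: "x \<in> C" "y \<in> C" and uv: "0 \<le> u" "0 \<le> v" "u + v = 1"
    have lin: "(\<Sum>i\<in>U. (u *\<^sub>R x + v *\<^sub>R y) $ i) = u * (\<Sum>i\<in>U. x $ i) + v * (\<Sum>i\<in>U. y $ i)" for U
      by (simp add: sum.distrib sum_distrib_left)
    have "u * (\<Sum>i\<in>U. x $ i) + v * (\<Sum>i\<in>U. y $ i) \<le> real (\<Sum>j<card U. part la j)" for U
      using xy uv by (intro convex_bound_le) (auto simp: C_def)
    moreover have "u * real (sum_list la) + v * real (sum_list la) = real (sum_list la)"
      using uv(3) by (simp flip: distrib_right)
    moreover have "0 \<le> (u *\<^sub>R x + v *\<^sub>R y) $ i" for i
      using xy uv(1,2) by (simp add: C_def)
    moreover have "(\<Sum>i\<in>UNIV. x $ i) = real (sum_list la)" "(\<Sum>i\<in>UNIV. y $ i) = real (sum_list la)"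
      using xy by (simp_all add: C_def)
    ultimately show "u *\<^sub>R x + v *\<^sub>R y \<in> C"
      unfolding C_def mem_Collect_eq lin by metis
  qed
  moreover have "(\<chi> i. real (part la (s i))) \<in> C" if s: "bij_betw s (UNIV :: 'n set) {..<CARD('n)}" for s
  proof -
    have "(\<Sum>i\<in>U. part la (s i)) \<le> (\<Sum>j<card U. part la j)" for U
    proof -
      have "inj_on s U" using s by (auto simp: bij_betw_def inj_on_def)
      then have "(\<Sum>i\<in>U. part la (s i)) = (\<Sum>j\<in>s ` U. part la j)" "card (s ` U) = card U"
        by (simp_all add: sum.reindex card_image)
      then show ?thesis using sum_antimono_le[OF is_partition_antimono[OF la], of "s ` U"] by simp
    qed
    moreover have "(\<Sum>i\<in>UNIV. part la (s i)) = sum_list la"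
      using sum.reindex_bij_betw[OF s, of "part la"] sum_part[OF len] by simp
    ultimately show ?thesis unfolding C_def by (simp flip: of_nat_sum)
  qed
  ultimately have "permutohedron la \<subseteq> C" unfolding permutohedron_def by (intro hull_minimal) auto
  then have xC: "x \<in> C" using x(1) by blast
  define a where "a = (\<chi> i. nat \<lfloor>x $ i\<rfloor>)"
  have xa: "x $ i = real (a $ i)" for i
  proof -
    have "x $ i = of_int \<lfloor>x $ i\<rfloor>" using x(2)[of i] by (metis Ints_cases floor_of_int)
    then show ?thesis using xC by (auto simp: a_def C_def)
  qed
  then have "x = real_vec a" by (simp add: vec_eq_iff real_vec_def)
  moreover have "a \<in> dominated_vectors la"
    using xC unfolding C_def dominated_vectors_def by (simp add: xa flip: of_nat_sum)
  ultimately show ?thesis by blast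
qed

section \<open>Supports of combinations of dual \<open>k\<close>-Schur polynomials\<close>

lemma lookup_dual_k_schur:
  fixes a :: "nat ^ 'n::{finite,linorder}"
  assumes "k_bounded_partition k mu"
  shows "Poly_Mapping.lookup (dual_k_schur k mu) a =
    real (card {T \<in> k_tableaux k mu. k_weight k (core_of k mu) T = a})"
proof -
  have "Poly_Mapping.lookup (dual_k_schur k mu) a =
      (\<Sum>T\<in>(k_tableaux k mu :: (nat \<times> nat \<Rightarrow> 'n) set). if k_weight k (core_of k mu) T = a then 1 else 0)"
    by (simp add: dual_k_schur_def lookup_sum lookup_single when_def)
  then show ?thesis using finite_k_tableaux[OF assms, where 'n = 'n] by (simp add: sum.If_cases Int_def)
qed

text \<open>Sums over infinite sets are zero by convention, so the expansion of \<open>f\<close>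
  relies on this. Parts are positive, hence the length is at most the size, which dominance
  bounds.\<close>

lemma finite_dominated_partitions:
  "finite {mu. k_bounded_partition k mu \<and> mu \<unlhd> la}"
proof (rule finite_subset)
  show "{mu. k_bounded_partition k mu \<and> mu \<unlhd> la} \<subseteq> {mu. set mu \<subseteq> {..k} \<and> length mu \<le> sum_list la}"
  proof clarify
    fix mu assume mu: "k_bounded_partition k mu" "mu \<unlhd> la"
    then have part: "is_partition mu" by (simp add: k_bounded_partition_def)
    define L where "L = length mu + length la"
    have "length mu = (\<Sum>j<length mu. 1)" by simp
    also have "\<dots> \<le> (\<Sum>j<length mu. part mu j)"
      using is_partition_part_pos[OF part] by (intro sum_mono) (simp add: Suc_le_eq)
    also have "\<dots> = sum_list mu" by (rule sum_part) simp
    also have "\<dots> = (\<Sum>j<L. part mu j)" by (rule sum_part[symmetric]) (simp add: L_def)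
    also have "\<dots> \<le> (\<Sum>j<L. part la j)" using mu(2) by (simp add: dominated_by_def)
    also have "\<dots> = sum_list la" by (rule sum_part) (simp add: L_def)
    finally show "set mu \<subseteq> {..k} \<and> length mu \<le> sum_list la"
      using mu(1) by (auto simp: k_bounded_partition_def)
  qed
  show "finite {mu. set mu \<subseteq> {..k} \<and> length mu \<le> sum_list la}"
    by (rule finite_lists_length_le) simp
qed

lemma dominated_by_antisym:
  assumes "is_partition mu" "is_partition la" "mu \<unlhd> la"
    and "\<And>i. (\<Sum>j<i. part la j) \<le> (\<Sum>j<i. part mu j)"
  shows "mu = la"
proof (rule is_partition_eqI[OF assms(1,2)])
  have eq: "(\<Sum>j<i. part mu j) = (\<Sum>j<i. part la j)" for i
    using assms(3,4) unfolding dominated_by_def by (meson order_antisym)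
  show "part mu = part la"
  proof
    show "part mu i = part la i" for i using eq[of i] eq[of "Suc i"] by simp
  qed
qed

lemma permutes_image_eq_card:
  fixes U V :: "'a::finite set"
  assumes "card U = card V"
  shows "\<exists>p. p permutes UNIV \<and> p ` U = V"
proof -
  obtain p1 where p1: "bij_betw p1 U V" using finite_same_card_bij[OF _ _ assms] by auto
  have "card (- U) = card (- V)" using assms by (simp add: Compl_eq_Diff_UNIV card_Diff_subset)
  then obtain p2 where p2: "bij_betw p2 (- U) (- V)" using finite_same_card_bij by (metis finite)
  define p where "p x = (if x \<in> U then p1 x else p2 x)" for x
  have 1: "bij_betw p U V" using p1 by (rule bij_betw_cong[THEN iffD1, rotated]) (simp add: p_def)
  have 2: "bij_betw p (- U) (- V)" using p2 by (rule bij_betw_cong[THEN iffD1, rotated]) (simp add: p_def)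
  have "bij_betw p (U \<union> - U) (V \<union> - V)" by (rule bij_betw_combine[OF 1 2]) simp
  then have "bij p" by (simp add: Compl_partition)
  then show ?thesis using 1 by (metis bij_betw_imp_surj_on bij_imp_permutes iso_tuple_UNIV_I)
qed

theorem theorem4p5:
  fixes k d :: nat
    and f :: "('n::{finite,linorder}) real_mpoly"
    and la :: "nat list"
    and c :: "nat list \<Rightarrow> real"
  assumes "k \<ge> 1"
    and "homogeneous_poly d f"
    and "symmetric_poly f"
    and "k_bounded_partition k la" and "sum_list la = d"
    and "length la \<le> CARD('n)"
    and "f = (\<Sum>mu | k_bounded_partition k mu \<and> mu \<unlhd> la. Poly_Mapping.map ((*) (c mu)) (dual_k_schur k mu))"
    and "c la \<noteq> 0"
  shows "newton f = permutohedron la \<and>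
    ((\<forall>mu. k_bounded_partition k mu \<and> mu \<unlhd> la \<longrightarrow> c mu \<ge> 0) \<longrightarrow>
       saturated_newton f \<and> M_convex f)"
proof -
  note k = assms(1) and la = assms(4) and len = assms(6)
  have part_la: "is_partition la" using la by (simp add: k_bounded_partition_def)
  define S where "S = {mu. k_bounded_partition k mu \<and> mu \<unlhd> la}"
  define N where "N mu a = {T \<in> k_tableaux k mu. k_weight k (core_of k mu) T = a}"
    for mu and a :: "(nat, 'n) vec"
  have finS: "finite S" unfolding S_def by (rule finite_dominated_partitions)
  have S: "k_bounded_partition k mu" "mu \<unlhd> la" "is_partition mu" if "mu \<in> S" for mu
    using that by (auto simp: S_def k_bounded_partition_def)
  have laS: "la \<in> S" using la by (simp add: S_def dominated_by_def)
  have finN: "finite (N mu a)" if "mu \<in> S" for mu a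
    unfolding N_def using finite_k_tableaux[OF S(1)[OF that], where 'n = 'n] by simp
  have coeff: "Poly_Mapping.lookup f a = (\<Sum>mu\<in>S. c mu * real (card (N mu a)))" for a
  proof -
    have "Poly_Mapping.lookup f a = (\<Sum>mu\<in>S. Poly_Mapping.lookup (Poly_Mapping.map ((*) (c mu)) (dual_k_schur k mu)) a)"
      unfolding assms(7) S_def[symmetric] lookup_sum ..
    also have "\<dots> = (\<Sum>mu\<in>S. c mu * real (card (N mu a)))"
    proof (rule sum.cong[OF refl])
      fix mu assume "mu \<in> S"
      then have "Poly_Mapping.lookup (dual_k_schur k mu) a = real (card (N mu a))"
        using lookup_dual_k_schur S(1) unfolding N_def by blast
      then show "Poly_Mapping.lookup (Poly_Mapping.map ((*) (c mu)) (dual_k_schur k mu)) a =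
          c mu * real (card (N mu a))"
        by (simp add: Poly_Mapping.map.rep_eq when_def)
    qed
    finally show ?thesis .
  qed
  have supp_tableau: "\<exists>mu\<in>S. c mu \<noteq> 0 \<and> (\<exists>T\<in>k_tableaux k mu. k_weight k (core_of k mu) T = a)"
    if "a \<in> supp f" for a
  proof (rule ccontr)
    assume *: "\<not> ?thesis"
    have "c mu * real (card (N mu a)) = 0" if "mu \<in> S" for mu
    proof -
      have "c mu = 0 \<or> N mu a = {}" using * that unfolding N_def by blast
      then show ?thesis by auto
    qed
    then have "Poly_Mapping.lookup f a = 0" unfolding coeff by (intro sum.neutral) blast
    then show False using that by (simp add: in_keys_iff)
  qed
  have sym: "(\<chi> i. a $ p i) \<in> supp f" if "a \<in> supp f" "p permutes UNIV" for a p
    using assms(3) that unfolding symmetric_poly_def in_keys_iff by metis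
  have supp_sub: "supp f \<subseteq> dominated_vectors la"
  proof
    fix a assume a: "a \<in> supp f"
    have "(\<Sum>x\<in>U. a $ x) \<le> (\<Sum>j<card U. part la j)" for U
    proof -
      \<comment> \<open>Symmetry replaces \<open>U\<close> by the set of the \<open>card U\<close>
        largest letters, to which the bound for upper sets applies.\<close>
      define U' where "U' = {x :: 'n. letters_above x < card U}"
      have "card U \<le> CARD('n)" by (intro card_mono) auto
      then have cardU': "card U' = card U" unfolding U'_def by (rule card_letters_above_less)
      then obtain p where p: "p permutes UNIV" "p ` U' = U" using permutes_image_eq_card by blast
      obtain mu T where mu: "mu \<in> S" and T: "T \<in> k_tableaux k mu"
        "k_weight k (core_of k mu) T = (\<chi> i. a $ p i)"
        using supp_tableau[OF sym[OF a p(1)]] by blast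
      have "inj_on p U'" using permutes_inj[OF p(1)] by (rule inj_on_subset) simp
      then have "(\<Sum>x\<in>U. a $ x) = (\<Sum>x\<in>U'. a $ p x)"
        unfolding p(2)[symmetric] by (simp add: sum.reindex)
      also have "\<dots> = (\<Sum>x\<in>U'. k_weight k (core_of k mu) T $ x)" by (simp add: T(2))
      also have "\<dots> \<le> (\<Sum>j<card U'. part mu j)"
      proof (rule k_weight_upper_set[OF S(1)[OF mu] k T(1)])
        fix x y assume "x \<in> U'" "x < y"
        then show "y \<in> U'" using letters_above_less_iff[of y x] by (simp add: U'_def)
      qed
      also have "\<dots> \<le> (\<Sum>j<card U. part la j)"
        using S(2)[OF mu] by (simp add: dominated_by_def cardU')
      finally show ?thesis .
    qed
    \<comment> \<open>The relation \<open>\<unlhd>\<close> does not fix the size, so the total comes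
      from homogeneity.\<close>
    moreover have "(\<Sum>x\<in>UNIV. a $ x) = sum_list la"
      using assms(2,5) a by (simp add: homogeneous_poly_def)
    ultimately show "a \<in> dominated_vectors la" by (simp add: dominated_vectors_def)
  qed
  define v where "v = (\<chi> x :: 'n. part la (letters_above x))"
  \<comment> \<open>The \<open>i\<close> largest letters carry the \<open>i\<close> largest parts of
    \<open>la\<close> in \<open>v\<close>, so a tableau of weight \<open>v\<close> forces
    \<open>mu\<close> to dominate \<open>la\<close>. Hence nothing cancels the term of
    \<open>la\<close> at \<open>v\<close>.\<close>
  have v_only: "mu = la" if mu: "mu \<in> S" and ne: "N mu v \<noteq> {}" for mu
  proof (rule dominated_by_antisym[OF S(3)[OF mu] part_la S(2)[OF mu]])
    obtain T where T: "T \<in> k_tableaux k mu" "k_weight k (core_of k mu) T = v"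
      using ne unfolding N_def by blast
    have le: "(\<Sum>j<i. part la j) \<le> (\<Sum>j<i. part mu j)" if "i \<le> CARD('n)" for i
    proof -
      define U where "U = {x :: 'n. letters_above x < i}"
      have "(\<Sum>j<i. part la j) = (\<Sum>x\<in>U. k_weight k (core_of k mu) T $ x)"
        unfolding T(2) v_def U_def using card_letters_above_less(2)[OF that, of "part la"] by simp
      also have "\<dots> \<le> (\<Sum>j<card U. part mu j)"
      proof (rule k_weight_upper_set[OF S(1)[OF mu] k T(1)])
        fix x y assume "x \<in> U" "x < y"
        then show "y \<in> U" using letters_above_less_iff[of y x] by (simp add: U_def)
      qed
      also have "card U = i" unfolding U_def by (rule card_letters_above_less(1)[OF that])
      finally show ?thesis .
    qed
    show "(\<Sum>j<i. part la j) \<le> (\<Sum>j<i. part mu j)" for i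
    proof (cases "i \<le> CARD('n)")
      \<comment> \<open>Having at most \<open>CARD('n)\<close> parts, \<open>la\<close> has already
        reached its full sum.\<close>
      case False
      then have "(\<Sum>j<i. part la j) = (\<Sum>j<CARD('n). part la j)"
        using len by (simp add: sum_part)
      also have "\<dots> \<le> (\<Sum>j<CARD('n). part mu j)" by (rule le) simp
      also have "\<dots> \<le> (\<Sum>j<i. part mu j)" using False by (intro sum_mono2) auto
      finally show ?thesis .
    qed (rule le)
  qed
  have "Poly_Mapping.lookup f v = c la * real (card (N la v))"
  proof -
    have "N mu v = {}" if "mu \<in> S - {la}" for mu using v_only that by blast
    then show ?thesis unfolding coeff by (simp add: sum.remove[OF finS laS])
  qed
  moreover have "N la v \<noteq> {}" using exists_k_tableau[OF la k len] unfolding N_def v_def by blast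
  ultimately have v: "v \<in> supp f" using assms(8) finN[OF laS] by (simp add: in_keys_iff)
  have vertices: "(\<chi> x. part la (s x)) \<in> supp f" if s: "bij_betw s (UNIV :: 'n set) {..<CARD('n)}" for s
  proof -
    define p :: "'n \<Rightarrow> 'n" where "p = inv letters_above \<circ> s"
    have "bij_betw p UNIV UNIV"
      unfolding p_def using bij_betw_inv_into[OF bij_letters_above] s by (rule bij_betw_trans[rotated])
    then have "p permutes UNIV" by (rule bij_imp_permutes) simp
    moreover have "letters_above (p x) = s x" for x
    proof -
      have "s x \<in> range (letters_above :: 'n \<Rightarrow> nat)"
        using s bij_letters_above[where 'n = 'n] unfolding bij_betw_def by blast
      then show ?thesis by (simp add: p_def f_inv_into_f)
    qed
    ultimately show ?thesis using sym[OF v, of p] by (simp add: v_def)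
  qed
  have newton: "newton f = permutohedron la"
  proof
    have "convex (permutohedron la :: ((real, 'n) vec) set)"
      unfolding permutohedron_def by (rule convex_convex_hull)
    then show "newton f \<subseteq> permutohedron la" unfolding newton_def
      using supp_sub dominated_vectors_permutohedron[OF len] by (intro hull_minimal) blast+
    show "permutohedron la \<subseteq> newton f" unfolding permutohedron_def newton_def
    proof (rule hull_mono, clarify)
      fix s assume "bij_betw s (UNIV :: 'n set) {..<CARD('n)}"
      then have "real_vec (\<chi> x. part la (s x)) \<in> real_vec ` supp f" using vertices by blast
      then show "(\<chi> i. real (part la (s i))) \<in> real_vec ` supp f" by (simp add: real_vec_def)
    qed
  qed
  moreover have "saturated_newton f \<and> M_convex f"
    if nonneg: "\<forall>mu. k_bounded_partition k mu \<and> mu \<unlhd> la \<longrightarrow> c mu \<ge> 0"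
  proof -
    \<comment> \<open>Nonnegative coefficients exclude cancellation between different
      \<open>mu\<close>.\<close>
    have supp_intro: "a \<in> supp f"
      if "mu \<in> S" "c mu \<noteq> 0" "T \<in> k_tableaux k mu" "k_weight k (core_of k mu) T = a" for mu T a
    proof -
      have nn: "0 \<le> c mu" if "mu \<in> S" for mu using nonneg that by (simp add: S_def)
      have "N mu a \<noteq> {}" using that unfolding N_def by blast
      then have "0 < c mu * real (card (N mu a))"
        using that nn[OF that(1)] finN[OF that(1)] by (simp add: card_gt_0_iff)
      then have "0 < Poly_Mapping.lookup f a"
        unfolding coeff using nn by (intro sum_pos2[OF finS that(1)]) auto
      then show ?thesis by (simp add: in_keys_iff)
    qed
    have closed: "a - axis i 1 + axis j 1 \<in> supp f" if a: "a \<in> supp f" and gap: "a $ j + 2 \<le> a $ i" for a i j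
    proof -
      have "i \<noteq> j" using gap by auto
      define x where "x = Min (UNIV :: 'n set)"
      define y where "y = Min (UNIV - {x})"
      have "i \<in> UNIV - {x} \<or> j \<in> UNIV - {x}" using \<open>i \<noteq> j\<close> by auto
      then have ne: "UNIV - {x} \<noteq> {}" by (metis empty_iff)
      have x: "x \<le> z" for z unfolding x_def by simp
      have "y \<in> UNIV - {x}" unfolding y_def using ne by (intro Min_in) auto
      then have "x < y" using x[of y] by auto
      have y: "y \<le> z" if "x < z" for z unfolding y_def using that by (intro Min_le) auto
      \<comment> \<open>The first transposition moves \<open>x\<close> to \<open>i\<close>; the
        second moves the image of \<open>y\<close> to \<open>j\<close> and fixes
        \<open>i\<close>.\<close>
      define p where "p = Transposition.transpose (Transposition.transpose x i y) j \<circ> Transposition.transpose x i"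
      have p: "p permutes UNIV" unfolding p_def by (intro permutes_compose permutes_swap_id) auto
      have px: "p x = i" and py: "p y = j"
        using \<open>i \<noteq> j\<close> \<open>x < y\<close> unfolding p_def by (auto simp: Transposition.transpose_def)
      define b where "b = (\<chi> z. a $ p z)"
      obtain mu T where mu: "mu \<in> S" "c mu \<noteq> 0" and T: "T \<in> k_tableaux k mu"
        "k_weight k (core_of k mu) T = b"
        using supp_tableau[OF sym[OF a p]] unfolding b_def by blast
      \<comment> \<open>The inequality for a singleton bounds \<open>a $ i\<close> by the largest
        part of \<open>la\<close>, hence by \<open>k\<close>, as \<open>k_tableau_transfer\<close>
        requires.\<close>
      have "(\<Sum>z\<in>{i}. a $ z) \<le> (\<Sum>j<card {i}. part la j)"
        using supp_sub a unfolding dominated_vectors_def by blast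
      then have "a $ i \<le> k"
        using bounded_coreD(2)[OF core_of_bounded_core(2)[OF la], of 0] by simp
      then obtain T' where "T' \<in> k_tableaux k mu"
        "k_weight k (core_of k mu) T' = b - axis x 1 + axis y 1"
        using k_tableau_transfer[OF S(1)[OF mu(1)] k T(1) x \<open>x < y\<close> y] gap
        unfolding T(2) b_def by (auto simp: px py)
      then have "b - axis x 1 + axis y 1 \<in> supp f" using supp_intro[OF mu] by blast
      then have "(\<chi> z. (b - axis x 1 + axis y 1) $ inv p z) \<in> supp f"
        by (rule sym[OF _ permutes_inv[OF p]])
      moreover have "(\<chi> z. (b - axis x 1 + axis y 1) $ inv p z) = a - axis i 1 + axis j 1"
      proof -
        have "inv p z = x \<longleftrightarrow> z = i" "inv p z = y \<longleftrightarrow> z = j" for z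
          using permutes_inv_eq[OF p] px py by auto
        then show ?thesis
          by (simp add: vec_eq_iff b_def axis_def permutes_inverses(1)[OF p])
      qed
      ultimately show ?thesis by simp
    qed
    have supp: "supp f = dominated_vectors la"
      using supp_sub dominated_vectors_induct[where P = "\<lambda>a. a \<in> supp f", OF len _ vertices closed]
      by blast
    have "saturated_newton f"
      unfolding saturated_newton_def newton supp
    proof (intro equalityI subsetI)
      fix z :: "(real, 'n) vec" assume "z \<in> real_vec ` dominated_vectors la"
      then show "z \<in> permutohedron la \<inter> {x. \<forall>i. x $ i \<in> \<int>}"
        using dominated_vectors_permutohedron[OF len] by (auto simp: real_vec_def)
    next
      fix z :: "(real, 'n) vec" assume "z \<in> permutohedron la \<inter> {x. \<forall>i. x $ i \<in> \<int>}"
      then show "z \<in> real_vec ` dominated_vectors la"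
        using integral_permutohedron[OF part_la len] by blast
    qed
    moreover have "M_convex f"
      unfolding M_convex_def supp using dominated_vectors_exchange[OF part_la] by blast
    ultimately show ?thesis ..
  qed
  ultimately show ?thesis by blast
qed

end
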